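(* Let $G$ be a periodic near abelian locally compact group with base $A$ such that $G$ is $A$-nontrivial. Let $D$ be the largest divisible subgroup of the periodic inductively monothetic group $G/A$, i.e. the closed subgroup of elements of $G/A$ whose $p$-primary components vanish for every prime $p$ for which $(G/A)_p$ is not divisible, and let $G_D$ be the full preimage of $D$ under the quotient map $G\to G/A$. Then $A\subseteq G_D\subseteq C_G(A)$, $G_D$ is an abelian normal subgroup of $G$, and $G/G_D$ is $\Pi$-procyclic.
   Context: A topological group $G$ is periodic if it is locally compact, totally disconnected, and $\overline{\langle g\rangle}$ is compact for every $g\in G$. A topological group is inductively monothetic if for every finite subset $F$ there is $g$ with $\overline{\langle F\rangle}=\overline{\langle g\rangle}$. A topological group $G$ is near abelian if it is locally compact and contains a closed abelian subgroup $A$ (a base) such that $G/A$ is an abelian inductively monothetic group and every closed subgroup of $A$ is normal in $G$. With $\psi\colon G/A\to\mathrm{Aut}(A)$, $\psi(gA)(a)=gag^{-1}$, $G$ is $A$-nontrivial if $\psi(G/A)$ has more than $2$ elements. For a periodic locally compact abelian group $B$ and a prime $p$, the $p$-primary component $B_p$ is the set of $b\in B$ such that $\overline{\langle b\rangle}$ is a pro-$p$ group. A topological group $B$ is $\Pi$-procyclic if it is a periodic locally compact abelian group each of whose $p$-primary components $B_p$ is either a finite cyclic $p$-group (possibly trivial) or isomorphic to the $p$-adic integers $\mathbb{Z}_p$. $C_G(A)$ denotes the centraliser of $A$ in $G$. *)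

theory Defs
  imports "HOL-Analysis.Analysis" "HOL-Algebra.Algebra"
begin

definition topological_group :: "('a, 'b) monoid_scheme \<Rightarrow> 'a topology \<Rightarrow> bool" where
  "topological_group G T \<longleftrightarrow> group G \<and> topspace T = carrier G \<and>
     continuous_map (prod_topology T T) T (\<lambda>(x, y). x \<otimes>\<^bsub>G\<^esub> y) \<and>
     continuous_map T T (\<lambda>x. inv\<^bsub>G\<^esub> x)"

definition lc_group :: "('a, 'b) monoid_scheme \<Rightarrow> 'a topology \<Rightarrow> bool" where
  "lc_group G T \<longleftrightarrow> topological_group G T \<and> Hausdorff_space T \<and> locally_compact_space T"

definition totally_disconnected_space :: "'a topology \<Rightarrow> bool" where
  "totally_disconnected_space T \<longleftrightarrow> (\<forall>x \<in> topspace T. connected_component_of_set T x = {x})"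

definition cl_gen :: "('a, 'b) monoid_scheme \<Rightarrow> 'a topology \<Rightarrow> 'a set \<Rightarrow> 'a set" where
  "cl_gen G T S = T closure_of (generate G S)"

definition periodic_group :: "('a, 'b) monoid_scheme \<Rightarrow> 'a topology \<Rightarrow> bool" where
  "periodic_group G T \<longleftrightarrow> lc_group G T \<and> totally_disconnected_space T \<and>
     (\<forall>g \<in> carrier G. compactin T (cl_gen G T {g}))"

definition inductively_monothetic :: "('a, 'b) monoid_scheme \<Rightarrow> 'a topology \<Rightarrow> bool" where
  "inductively_monothetic G T \<longleftrightarrow> topological_group G T \<and>
     (\<forall>F. finite F \<and> F \<subseteq> carrier G \<longrightarrow> (\<exists>g \<in> carrier G. cl_gen G T F = cl_gen G T {g}))"

definition quot_top :: "('a, 'b) monoid_scheme \<Rightarrow> 'a topology \<Rightarrow> 'a set \<Rightarrow> 'a set topology" where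
  "quot_top G T H = topology (\<lambda>U. U \<subseteq> rcosets\<^bsub>G\<^esub> H \<and> openin T (\<Union>U))"

definition abelian_set :: "('a, 'b) monoid_scheme \<Rightarrow> 'a set \<Rightarrow> bool" where
  "abelian_set G A \<longleftrightarrow> (\<forall>x \<in> A. \<forall>y \<in> A. x \<otimes>\<^bsub>G\<^esub> y = y \<otimes>\<^bsub>G\<^esub> x)"

definition centraliser :: "('a, 'b) monoid_scheme \<Rightarrow> 'a set \<Rightarrow> 'a set" where
  "centraliser G A = {g \<in> carrier G. \<forall>a \<in> A. g \<otimes>\<^bsub>G\<^esub> a = a \<otimes>\<^bsub>G\<^esub> g}"

definition near_abelian :: "('a, 'b) monoid_scheme \<Rightarrow> 'a topology \<Rightarrow> 'a set \<Rightarrow> bool" where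
  "near_abelian G T A \<longleftrightarrow> lc_group G T \<and> subgroup A G \<and> closedin T A \<and> abelian_set G A \<and>
     normal A G \<and> comm_group (G Mod A) \<and> inductively_monothetic (G Mod A) (quot_top G T A) \<and>
     (\<forall>H. subgroup H G \<and> H \<subseteq> A \<and> closedin T H \<longrightarrow> normal H G)"

text \<open>The image of psi : G/A \<rightarrow> Aut(A), psi(gA)(a) = g a g^{-1}, as a set of maps on A.\<close>
definition psi_image :: "('a, 'b) monoid_scheme \<Rightarrow> 'a set \<Rightarrow> ('a \<Rightarrow> 'a) set" where
  "psi_image G A = (\<lambda>g. restrict (\<lambda>a. g \<otimes>\<^bsub>G\<^esub> a \<otimes>\<^bsub>G\<^esub> inv\<^bsub>G\<^esub> g) A) ` carrier G"

definition A_nontrivial :: "('a, 'b) monoid_scheme \<Rightarrow> 'a set \<Rightarrow> bool" where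
  "A_nontrivial G A \<longleftrightarrow> infinite (psi_image G A) \<or> 2 < card (psi_image G A)"

definition divisible_subgroup :: "('a, 'b) monoid_scheme \<Rightarrow> 'a set \<Rightarrow> bool" where
  "divisible_subgroup G H \<longleftrightarrow> subgroup H G \<and>
     (\<forall>x \<in> H. \<forall>n::nat. n > 0 \<longrightarrow> (\<exists>y \<in> H. y [^]\<^bsub>G\<^esub> n = x))"

text \<open>Largest divisible subgroup (union of all divisible subgroups; a subgroup in the abelian case).\<close>
definition largest_divisible_subgroup :: "('a, 'b) monoid_scheme \<Rightarrow> 'a set" where
  "largest_divisible_subgroup G = \<Union>{H. divisible_subgroup G H}"

definition pro_p_group :: "('a, 'b) monoid_scheme \<Rightarrow> 'a topology \<Rightarrow> nat \<Rightarrow> bool" where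
  "pro_p_group G T p \<longleftrightarrow> topological_group G T \<and> compact_space T \<and> Hausdorff_space T \<and>
     totally_disconnected_space T \<and>
     (\<forall>N. normal N G \<and> openin T N \<longrightarrow> (\<exists>k. card (rcosets\<^bsub>G\<^esub> N) = p ^ k))"

definition primary_component :: "('a, 'b) monoid_scheme \<Rightarrow> 'a topology \<Rightarrow> nat \<Rightarrow> 'a set" where
  "primary_component G T p = {b \<in> carrier G.
      pro_p_group (G\<lparr>carrier := cl_gen G T {b}\<rparr>) (subtopology T (cl_gen G T {b})) p}"

text \<open>The p-adic integers as the inverse limit of Z/p^n Z, with the inverse limit topology.\<close>
definition padic_carrier :: "nat \<Rightarrow> (nat \<Rightarrow> int) set" where
  "padic_carrier p = {x. \<forall>n. 0 \<le> x n \<and> x n < int p ^ n \<and> x n = x (Suc n) mod (int p ^ n)}"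

definition padic_group :: "nat \<Rightarrow> (nat \<Rightarrow> int) monoid" where
  "padic_group p = \<lparr>carrier = padic_carrier p,
                    mult = (\<lambda>x y n. (x n + y n) mod (int p ^ n)),
                    one = (\<lambda>n. 0)\<rparr>"

definition padic_topology :: "nat \<Rightarrow> (nat \<Rightarrow> int) topology" where
  "padic_topology p = subtopology (product_topology (\<lambda>n. discrete_topology UNIV) UNIV) (padic_carrier p)"

definition top_group_iso :: "('a, 'b) monoid_scheme \<Rightarrow> 'a topology \<Rightarrow> ('c, 'd) monoid_scheme \<Rightarrow> 'c topology \<Rightarrow> bool" where
  "top_group_iso G T H S \<longleftrightarrow> (\<exists>f. f \<in> iso G H \<and> homeomorphic_map T S f)"

definition Pi_procyclic :: "('a, 'b) monoid_scheme \<Rightarrow> 'a topology \<Rightarrow> bool" where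
  "Pi_procyclic G T \<longleftrightarrow> periodic_group G T \<and> comm_group G \<and>
     (\<forall>p::nat. Factorial_Ring.prime p \<longrightarrow>
        (let Bp = primary_component G T p in
          (finite Bp \<and> (\<exists>g \<in> Bp. generate G {g} = Bp) \<and> (\<exists>k. card Bp = p ^ k)) \<or>
          top_group_iso (G\<lparr>carrier := Bp\<rparr>) (subtopology T Bp) (padic_group p) (padic_topology p)))"

end

theory Submission
  imports Defs
begin

text \<open>
  By van Dantzig's theorem the compact open subgroups form a neighbourhood basis of the identity, so
  membership in closed subgroups can be tested modulo open subgroups, where every element has finite
  order.

  Let \<open>Q = G/A\<close> and write \<open>Q\<^sub>p\<close> for its \<open>p\<close>-primary component. If \<open>x, y \<in> Q\<^sub>p\<close>, then \<open>\<langle>x, y\<rangle>\<close> is topologically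
  generated by some \<open>z \<in> Q\<^sub>p\<close>, and either \<open>x\<close> generates it as well or \<open>x\<close> is a \<open>p\<close>-th power in it. Hence
  \<open>Q\<^sub>p\<close> is monothetic or divisible, and the largest divisible subgroup \<open>D\<close> of \<open>Q\<close> is the intersection of
  the closed subgroups of \<open>p'\<close>-elements over the primes \<open>p\<close> for which \<open>Q\<^sub>p\<close> is not divisible; in
  particular \<open>D\<close> is closed.

  For \<open>a \<in> A\<close> the group \<open>G\<close> permutes the finitely many residues of the closure of \<open>\<langle>a\<rangle>\<close> modulo an open
  subgroup, so \<open>m!\<close>-th powers fix the residue of \<open>a\<close> for a suitable \<open>m\<close>; as \<open>D\<close> is divisible, its
  preimage \<open>G\<^sub>D\<close> centralises \<open>A\<close>. Since \<open>G\<^sub>D/A\<close> is inductively monothetic and \<open>A\<close> is central in \<open>G\<^sub>D\<close>, the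
  group \<open>G\<^sub>D\<close> is abelian. Finally \<open>G/G\<^sub>D\<close> is inductively monothetic without divisible subgroups, so each
  of its primary components is monothetic: finite cyclic, or isomorphic to the \<open>p\<close>-adic integers by
  reading off residues modulo the closures of \<open>\<langle>b\<^bsup>p\<^sup>n\<^esup>\<rangle>\<close> for a generator \<open>b\<close>.
\<close>

section \<open>Topological groups and compact open subgroups\<close>

definition open_subgroup :: "('a, 'b) monoid_scheme \<Rightarrow> 'a topology \<Rightarrow> 'a set \<Rightarrow> bool" where
  "open_subgroup G T U \<longleftrightarrow> subgroup U G \<and> openin T U"

locale top_group = group G for G (structure) +
  fixes T :: "'a topology"
  assumes topological: "topological_group G T"
begin

lemma topspace_eq [simp]: "topspace T = carrier G"
  using topological by (simp add: topological_group_def)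

lemma continuous_mult:
  assumes "continuous_map Y T f" "continuous_map Y T g"
  shows "continuous_map Y T (\<lambda>x. f x \<otimes> g x)"
proof -
  have "continuous_map Y (prod_topology T T) (\<lambda>x. (f x, g x))"
    using assms by (simp add: continuous_map_pairedI)
  then have "continuous_map Y T ((\<lambda>(x, y). x \<otimes> y) \<circ> (\<lambda>x. (f x, g x)))"
    using continuous_map_compose topological unfolding topological_group_def by blast
  then show ?thesis by (simp add: o_def)
qed

lemma continuous_translations:
  assumes "g \<in> carrier G"
  shows "continuous_map T T (\<lambda>x. x \<otimes> g)" "continuous_map T T (\<lambda>x. g \<otimes> x)"
  using assms by (auto intro!: continuous_mult)

text \<open>As a preimage under a translation, a coset of an open or closed set is open or closed by
  continuity.\<close>

lemma r_coset_eq_preimage: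
  assumes "U \<subseteq> carrier G" "g \<in> carrier G"
  shows "U #> g = {x \<in> topspace T. x \<otimes> inv g \<in> U}"
proof -
  have "x \<in> U #> g" if "x \<in> carrier G" "x \<otimes> inv g \<in> U" for x
    using that assms inv_solve_right unfolding r_coset_def by (force simp: m_assoc)
  then show ?thesis
    using assms by (auto simp: r_coset_def subset_iff m_assoc)
qed

lemma mem_r_coset_iff:
  assumes "subgroup U G" "g \<in> carrier G"
  shows "x \<in> U #> g \<longleftrightarrow> x \<in> carrier G \<and> x \<otimes> inv g \<in> U"
  using assms subgroup.subset[OF assms(1)] by (simp add: r_coset_eq_preimage)

lemma subgroup_nat_pow_closed:
  assumes "subgroup H G" "h \<in> H"
  shows "h [^] (n::nat) \<in> H"
  using subgroup_int_pow_closed[OF assms, of "int n"] by (simp add: int_pow_int)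

lemma openin_r_coset:
  assumes "openin T U" "g \<in> carrier G"
  shows "openin T (U #> g)"
proof -
  have "U \<subseteq> carrier G" using openin_subset[OF assms(1)] by simp
  then show ?thesis
    using openin_continuous_map_preimage[OF continuous_translations(1) assms(1), of "inv g"] assms(2)
    by (simp add: r_coset_eq_preimage)
qed

lemma closedin_r_coset:
  assumes "closedin T U" "g \<in> carrier G"
  shows "closedin T (U #> g)"
proof -
  have "U \<subseteq> carrier G" using closedin_subset[OF assms(1)] by simp
  then show ?thesis
    using closedin_continuous_map_preimage[OF continuous_translations(1) assms(1), of "inv g"] assms(2)
    by (simp add: r_coset_eq_preimage)
qed

text \<open>The complement is a union of further cosets \<open>U #> x\<close>, and these are
  open.\<close>

lemma open_subgroup_closedin:
  assumes "open_subgroup G T U"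
  shows "closedin T U"
proof -
  have U: "subgroup U G" "openin T U" using assms by (auto simp: open_subgroup_def)
  have "openin T (topspace T - U)"
  proof (subst openin_subopen, clarify)
    fix x assume x: "x \<in> topspace T" "x \<notin> U"
    have "(U #> x) \<inter> U = {}"
    proof (rule ccontr)
      assume "(U #> x) \<inter> U \<noteq> {}"
      then obtain u where u: "u \<in> U" "u \<otimes> x \<in> U" by (auto simp: r_coset_def)
      then have "inv u \<otimes> (u \<otimes> x) \<in> U"
        using U subgroup.m_closed subgroup.m_inv_closed by metis
      moreover have "inv u \<otimes> (u \<otimes> x) = x"
        using u x U by (metis inv_solve_left m_closed subgroup.mem_carrier topspace_eq)
      ultimately show False using x by simp
    qed
    moreover have "openin T (U #> x)" using openin_r_coset U x by simp
    moreover have "x \<in> U #> x" using rcos_self U x by simp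
    ultimately show "\<exists>V. openin T V \<and> x \<in> V \<and> V \<subseteq> topspace T - U"
      using openin_subset by blast
  qed
  then show ?thesis using subgroup.subset[OF U(1)] by (simp add: closedin_def)
qed

lemma open_subgroup_Int:
  "open_subgroup G T U \<Longrightarrow> open_subgroup G T V \<Longrightarrow> open_subgroup G T (U \<inter> V)"
  by (auto simp: open_subgroup_def subgroups_Inter_pair)

text \<open>A continuous map sends the closure of a set into the closure of its image, and the
  closure of \<open>H \<times> H\<close> is the product of the closures. This is applied to
  multiplication and inversion.\<close>

lemma subgroup_closure_of:
  assumes "subgroup H G"
  shows "subgroup (T closure_of H) G"
proof
  have sub: "H \<subseteq> topspace T" using assms subgroup.subset by fastforce
  then have in_cl: "H \<subseteq> T closure_of H" by (rule closure_of_subset)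
  show "T closure_of H \<subseteq> carrier G" using closure_of_subset_topspace topspace_eq by metis
  show "\<one> \<in> T closure_of H" using in_cl assms subgroup.one_closed by blast
  have "(\<lambda>(x, y). x \<otimes> y) ` ((prod_topology T T) closure_of (H \<times> H))
        \<subseteq> T closure_of ((\<lambda>(x, y). x \<otimes> y) ` (H \<times> H))"
    using topological continuous_map_image_closure_subset unfolding topological_group_def by blast
  moreover have "(\<lambda>(x, y). x \<otimes> y) ` (H \<times> H) \<subseteq> H"
    using assms by (auto simp: subgroup.m_closed)
  ultimately have "(\<lambda>(x, y). x \<otimes> y) ` ((T closure_of H) \<times> (T closure_of H)) \<subseteq> T closure_of H"
    using closure_of_mono closure_of_Times by (metis subset_trans)
  then show "\<And>x y. x \<in> T closure_of H \<Longrightarrow> y \<in> T closure_of H \<Longrightarrow> x \<otimes> y \<in> T closure_of H"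
    by auto
  have "(\<lambda>x. inv x) ` (T closure_of H) \<subseteq> T closure_of ((\<lambda>x. inv x) ` H)"
    using topological continuous_map_image_closure_subset unfolding topological_group_def by blast
  moreover have "(\<lambda>x. inv x) ` H \<subseteq> H" using assms by (auto simp: subgroup.m_inv_closed)
  ultimately show "\<And>x. x \<in> T closure_of H \<Longrightarrow> inv x \<in> T closure_of H"
    using closure_of_mono by blast
qed

lemma cl_gen_subgroup: "S \<subseteq> carrier G \<Longrightarrow> subgroup (cl_gen G T S) G"
  unfolding cl_gen_def by (intro subgroup_closure_of generate_is_subgroup)

lemma closedin_cl_gen: "closedin T (cl_gen G T S)"
  unfolding cl_gen_def by simp

lemma cl_gen_incl: "S \<subseteq> carrier G \<Longrightarrow> S \<subseteq> cl_gen G T S"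
  unfolding cl_gen_def
  using closure_of_subset[of "generate G S" T] generate_incl[of S] generate.incl[of _ S G] by auto

lemma cl_gen_minimal:
  assumes "subgroup H G" "closedin T H" "S \<subseteq> H"
  shows "cl_gen G T S \<subseteq> H"
  unfolding cl_gen_def 
  by (rule closure_of_minimal[OF generate_subgroup_incl[OF assms(3,1)] assms(2)])

lemma closedin_centralizer:
  assumes "Hausdorff_space T" "g \<in> carrier G"
  shows "closedin T {x \<in> carrier G. x \<otimes> g = g \<otimes> x}"
  using closedin_continuous_maps_eq[OF assms(1) continuous_translations[OF assms(2)]] by simp

text \<open>The stabiliser of a compact open neighbourhood of the identity is a compact open
  subgroup: openness is the tube lemma, and it is contained in the neighbourhood because it moves
  the identity inside it.\<close>

lemma van_Dantzig:
  assumes haus: "Hausdorff_space T" and lc: "locally_compact_space T"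
    and td: "totally_disconnected_space T" and W: "openin T W" "\<one> \<in> W"
  shows "\<exists>U. open_subgroup G T U \<and> compactin T U \<and> U \<subseteq> W"
proof -
  obtain V' K where V': "openin T V'" "\<one> \<in> V'" "V' \<subseteq> K" and K: "compactin T K"
    using lc unfolding locally_compact_space_def by (metis one_closed topspace_eq)
  define V where "V = V' \<inter> W"
  have V: "openin T V" "\<one> \<in> V" "V \<subseteq> K" "V \<subseteq> W" using V' W by (auto simp: V_def)
  define Y where "Y = subtopology T K"
  have Ksub: "K \<subseteq> carrier G" using K compactin_subset_topspace topspace_eq by metis
  have Y: "compact_space Y" "Hausdorff_space Y" "topspace Y = K"
    using K haus Ksub unfolding Y_def
    by (auto simp: compact_space_subtopology Hausdorff_space_subtopology)
  \<comment> \<open>In a compact Hausdorff space, two closed sets that no connected set meets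
    simultaneously are separated by a clopen partition. Here a connected set through
    \<open>\<one>\<close> is just \<open>{\<one>}\<close>.\<close>
  have "separated_between Y {\<one>} (K - V)"
  proof (rule cut_wire_fence_theorem_gen)
    show "compactin Y {\<one>}" using Y V by auto
    have "openin Y (V \<inter> K)" unfolding Y_def using V by (simp add: openin_subtopology_Int)
    then show "closedin Y (K - V)" using Y V by (simp add: Int_absorb2 closedin_def Diff_Diff_Int Int_absorb1)
    fix C assume C: "connectedin Y C"
    show "disjnt C {\<one>} \<or> disjnt C (K - V)"
    proof (cases "\<one> \<in> C")
      case True
      have "connectedin T C" using C by (simp add: Y_def connectedin_subtopology)
      then have "C \<subseteq> connected_component_of_set T \<one>" using True by (simp add: connected_component_of_maximal)
      then have "C \<subseteq> {\<one>}" using td by (auto simp: totally_disconnected_space_def)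
      then show ?thesis using V by (auto simp: disjnt_def)
    qed auto
  qed (use Y in auto)
  then obtain C B where CB: "openin Y C" "openin Y B" "C \<union> B = topspace Y" "disjnt C B" "\<one> \<in> C" "K - V \<subseteq> B"
    unfolding separated_between_def by auto
  have CV: "C \<subseteq> V" using CB Y by (auto simp: disjnt_def)
  have "topspace Y - C = B" using CB by (auto simp: disjnt_def)
  then have "closedin Y C" using CB by (auto simp: closedin_def)
  then have "compactin Y C" using Y closedin_compact_space by blast
  then have Ccomp: "compactin T C" by (simp add: Y_def compactin_subtopology)
  have Copen: "openin T C"
  proof -
    obtain Z where "openin T Z" "C = Z \<inter> K" using CB unfolding Y_def openin_subtopology by auto
    \<comment> \<open>Openness relative to \<open>K\<close> lifts to \<open>T\<close> because
      \<open>C\<close> lies in the open set \<open>V\<close> inside \<open>K\<close>.\<close>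
    then have "C = Z \<inter> V" using CV V by auto
    then show ?thesis using \<open>openin T Z\<close> V by auto
  qed
  have Csub: "C \<subseteq> carrier G" using Copen openin_subset by force
  define U where "U = {g \<in> carrier G. C #> g = C}"
  have Usub: "subgroup U G"
  proof
    show "U \<subseteq> carrier G" by (auto simp: U_def)
    show "\<one> \<in> U" using Csub by (simp add: U_def)
    show "x \<otimes> y \<in> U" if "x \<in> U" "y \<in> U" for x y
      using that Csub coset_mult_assoc[of C x y] by (simp add: U_def)
    show "inv x \<in> U" if "x \<in> U" for x
      using that Csub coset_mult_assoc[of C x "inv x"] by (simp add: U_def)
  qed
  have "openin (prod_topology T T) {z \<in> topspace (prod_topology T T). (\<lambda>(x, y). x \<otimes> y) z \<in> C}"
    using Copen topological openin_continuous_map_preimage unfolding topological_group_def by blast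
  moreover have "C \<times> {\<one>} \<subseteq> {z \<in> topspace (prod_topology T T). (\<lambda>(x, y). x \<otimes> y) z \<in> C}"
    using Csub by auto
  ultimately obtain N1 N where N: "openin T N1" "openin T N" "C \<subseteq> N1" "{\<one>} \<subseteq> N"
    "N1 \<times> N \<subseteq> {z \<in> topspace (prod_topology T T). (\<lambda>(x, y). x \<otimes> y) z \<in> C}"
    by (rule Wallace_theorem_prod_topology[OF Ccomp, of T "{\<one>}", rotated]) auto
  \<comment> \<open>Symmetry of \<open>M\<close> gives \<open>C #> g \<subseteq> C\<close> and
    \<open>C #> inv g \<subseteq> C\<close> together, hence equality.\<close>
  define M where "M = N \<inter> {x \<in> topspace T. inv x \<in> N}"
  have M: "openin T M" "\<one> \<in> M"
    unfolding M_def using N openin_continuous_map_preimage[of T T "\<lambda>x. inv x" N] topological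
    by (auto simp: topological_group_def)
  have MU: "M \<subseteq> U"
  proof
    fix g assume g: "g \<in> M"
    then have gc: "g \<in> carrier G" by (simp add: M_def)
    have 1: "C #> g \<subseteq> C" "C #> inv g \<subseteq> C"
      using g N(3) subsetD[OF N(5)] unfolding M_def r_coset_def by fastforce+
    then have "C #> inv g #> g \<subseteq> C #> g" by (auto simp: r_coset_def)
    then have "C \<subseteq> C #> g" using Csub gc by (simp add: coset_mult_assoc)
    then show "g \<in> U" using 1 gc by (auto simp: U_def)
  qed
  have "openin T U"
  proof (subst openin_subopen, clarify)
    fix x assume x: "x \<in> U"
    have xc: "x \<in> carrier G" using x by (simp add: U_def)
    have "openin T (M #> x)" using M xc openin_r_coset by blast
    moreover have "x \<in> M #> x" using M xc by (force simp: r_coset_def)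
    moreover have "M #> x \<subseteq> U" using MU x Usub by (auto simp: r_coset_def subgroup.m_closed)
    ultimately show "\<exists>S. openin T S \<and> x \<in> S \<and> S \<subseteq> U" by blast
  qed
  then have os: "open_subgroup G T U" using Usub by (simp add: open_subgroup_def)
  have "U \<subseteq> C"
  proof
    fix g assume "g \<in> U"
    then have "g \<in> carrier G" "C #> g = C" by (auto simp: U_def)
    moreover have "\<one> \<otimes> g \<in> C #> g" using CB by (force simp: r_coset_def)
    ultimately show "g \<in> C" by simp
  qed
  moreover have "compactin T U" using closed_compactin[OF Ccomp \<open>U \<subseteq> C\<close>] open_subgroup_closedin[OF os] by blast
  ultimately show ?thesis using os CV V by blast
qed

end

section \<open>Quotients of periodic groups\<close>

text \<open>Local compactness and total disconnectedness are replaced by a basis of compact open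
  subgroups at the identity, which passes to quotients by taking images. By
  \<open>td_group_if_periodic\<close> and \<open>periodic\<close> this is equivalent to
  periodicity.\<close>

locale td_group = top_group +
  assumes Hausdorff: "Hausdorff_space T"
    and compact_open_basis:
      "\<And>W. openin T W \<Longrightarrow> \<one> \<in> W \<Longrightarrow> \<exists>U. open_subgroup G T U \<and> compactin T U \<and> U \<subseteq> W"
    and compactin_cl_gen: "\<And>g. g \<in> carrier G \<Longrightarrow> compactin T (cl_gen G T {g})"
begin

lemma open_subgroup_separates:
  assumes "x \<in> carrier G" "x \<noteq> \<one>"
  shows "\<exists>U. open_subgroup G T U \<and> x \<notin> U"
proof -
  have "closedin T {x}" using assms Hausdorff by (simp add: closedin_Hausdorff_sing_eq)
  then have "openin T (carrier G - {x})" by (simp add: closedin_def)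
  then show ?thesis using compact_open_basis[of "carrier G - {x}"] assms by auto
qed

lemma eq_if_all_open_subgroups:
  assumes "x \<in> carrier G" "y \<in> carrier G" "\<And>U. open_subgroup G T U \<Longrightarrow> x \<otimes> inv y \<in> U"
  shows "x = y"
  using open_subgroup_separates[of "x \<otimes> inv y"] assms
  by (metis inv_closed inv_equality inv_inv m_closed)

text \<open>The cosets \<open>U #> x\<close> of open subgroups form a neighbourhood basis of
  \<open>x\<close>, so closures can be tested by congruences.\<close>

lemma in_closure_of_iff:
  assumes "S \<subseteq> carrier G" "x \<in> carrier G"
  shows "x \<in> T closure_of S \<longleftrightarrow> (\<forall>U. open_subgroup G T U \<longrightarrow> (\<exists>s \<in> S. s \<otimes> inv x \<in> U))"
proof
  assume cl: "x \<in> T closure_of S"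
  show "\<forall>U. open_subgroup G T U \<longrightarrow> (\<exists>s \<in> S. s \<otimes> inv x \<in> U)"
  proof (intro allI impI)
    fix U assume U: "open_subgroup G T U"
    then have "openin T (U #> x)" "x \<in> U #> x"
      using assms openin_r_coset rcos_self by (auto simp: open_subgroup_def)
    then obtain s where "s \<in> S" "s \<in> U #> x" using cl unfolding in_closure_of by blast
    then show "\<exists>s \<in> S. s \<otimes> inv x \<in> U"
      using U assms by (auto simp: open_subgroup_def mem_r_coset_iff)
  qed
next
  assume R: "\<forall>U. open_subgroup G T U \<longrightarrow> (\<exists>s \<in> S. s \<otimes> inv x \<in> U)"
  show "x \<in> T closure_of S"
    unfolding in_closure_of
  proof (intro conjI allI impI)
    show "x \<in> topspace T" using assms by simp
    fix W assume W: "x \<in> W \<and> openin T W"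
    have Wsub: "W \<subseteq> carrier G" using W openin_subset topspace_eq by metis
    have "openin T (W #> inv x)" using W openin_r_coset assms by simp
    moreover have "\<one> \<in> W #> inv x" using W assms by (force simp: r_coset_def)
    ultimately obtain U where U: "open_subgroup G T U" "U \<subseteq> W #> inv x"
      using compact_open_basis by blast
    then obtain s where "s \<in> S" "s \<otimes> inv x \<in> W #> inv x" using R by blast
    then have "s \<in> S" "s \<in> W"
      using assms Wsub by (auto simp: r_coset_eq_preimage m_assoc subset_iff)
    then show "\<exists>y. y \<in> S \<and> y \<in> W" by blast
  qed
qed

text \<open>The compact closure of the cyclic group is covered by finitely many cosets of
  \<open>U\<close>, so two different powers of \<open>x\<close> share a coset and their quotient
  lies in \<open>U\<close>.\<close>

lemma pow_in_open_subgroup: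
  assumes x: "x \<in> carrier G" and U: "open_subgroup G T U"
  shows "\<exists>m::nat. 0 < m \<and> x [^] m \<in> U"
proof -
  have sU: "subgroup U G" "openin T U" using U by (auto simp: open_subgroup_def)
  have sC: "subgroup (cl_gen G T {x}) G" using cl_gen_subgroup x by simp
  have xin: "x [^] (i::nat) \<in> cl_gen G T {x}" for i
    using cl_gen_incl[of "{x}"] x sC
    by (simp add: subgroup_nat_pow_closed)
  have "cl_gen G T {x} \<subseteq> \<Union>((\<lambda>y. U #> y) ` cl_gen G T {x})"
    using rcos_self[OF _ sU(1)] subgroup.subset[OF sC] by blast
  moreover have "\<forall>V \<in> (\<lambda>y. U #> y) ` cl_gen G T {x}. openin T V"
    using openin_r_coset[OF sU(2)] subgroup.subset[OF sC] by blast
  ultimately obtain F where F: "finite F" "F \<subseteq> (\<lambda>y. U #> y) ` cl_gen G T {x}" "cl_gen G T {x} \<subseteq> \<Union>F"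
    using compactin_cl_gen[OF x] unfolding compactin_def by metis
  have "(\<lambda>i::nat. U #> (x [^] i)) ` UNIV \<subseteq> F"
  proof clarify
    fix i :: nat
    obtain V where V: "V \<in> F" "x [^] i \<in> V" using F xin by blast
    then obtain y where "y \<in> cl_gen G T {x}" "V = U #> y" using F by blast
    moreover have "y \<in> carrier G" using \<open>y \<in> cl_gen G T {x}\<close> sC subgroup.subset by blast
    ultimately show "U #> x [^] i \<in> F" using V repr_independence[OF _ _ sU(1)] by metis
  qed
  then have "finite (range (\<lambda>i::nat. U #> (x [^] i)))" using F finite_subset by blast
  then have "\<not> inj (\<lambda>i::nat. U #> (x [^] i))" using finite_imageD infinite_UNIV_nat by blast
  then obtain i j :: nat where ij: "i < j" "U #> (x [^] i) = U #> (x [^] j)"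
    unfolding inj_def by (metis linorder_neqE_nat)
  have "x [^] j \<in> U #> (x [^] i)" using ij rcos_self[OF _ sU(1)] x by simp
  then have "x [^] j \<otimes> inv (x [^] i) \<in> U" using sU x by (simp add: mem_r_coset_iff)
  moreover have "x [^] j = x [^] (j - i) \<otimes> x [^] i" using ij x by (simp add: nat_pow_mult)
  ultimately have "x [^] (j - i) \<in> U" using x by (simp add: m_assoc)
  then show ?thesis using ij by (intro exI[of _ "j - i"]) simp
qed

lemma mem_cl_gen_iff:
  assumes "x \<in> carrier G" "y \<in> carrier G"
  shows "y \<in> cl_gen G T {x} \<longleftrightarrow>
    (\<forall>U. open_subgroup G T U \<longrightarrow> (\<exists>i::int. x [^] i \<otimes> inv y \<in> U))"
proof -
  have "(\<exists>s \<in> generate G {x}. s \<otimes> inv y \<in> U) \<longleftrightarrow> (\<exists>i::int. x [^] i \<otimes> inv y \<in> U)" for U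
    unfolding generate_pow[OF assms(1)] by blast
  then show ?thesis
    using assms in_closure_of_iff[of "generate G {x}" y] generate_incl[of "{x}"]
    unfolding cl_gen_def by simp
qed

text \<open>Reducing the exponent modulo \<open>m\<close> leaves at most \<open>m\<close> residues
  modulo \<open>U\<close>, a bound used later to count conjugates.\<close>

lemma cl_gen_cong_pow:
  assumes x: "x \<in> carrier G" and y: "y \<in> cl_gen G T {x}" and U: "open_subgroup G T U"
    and m: "0 < m" "x [^] (m::nat) \<in> U"
  shows "\<exists>r<m. x [^] r \<otimes> inv y \<in> U"
proof -
  have yc: "y \<in> carrier G" using y x cl_gen_subgroup[of "{x}"] subgroup.subset by fastforce
  have sU: "subgroup U G" using U by (simp add: open_subgroup_def)
  obtain i :: int where i: "x [^] i \<otimes> inv y \<in> U" using mem_cl_gen_iff[OF x yc] y U by blast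
  define r where "r = nat (i mod int m)"
  have r: "r < m" "int r = i - int m * (i div int m)"
    using m by (auto simp: r_def nat_less_iff minus_mult_div_eq_mod)
  have "x [^] r = x [^] (int m * (- (i div int m)) + i)"
    using r(2) by (simp add: int_pow_int[symmetric])
  also have "\<dots> = (x [^] int m) [^] (- (i div int m)) \<otimes> x [^] i"
    using x by (metis int_pow_mult int_pow_pow)
  finally have "x [^] r \<otimes> inv y = (x [^] m) [^] (- (i div int m)) \<otimes> (x [^] i \<otimes> inv y)"
    using x yc by (simp add: m_assoc int_pow_int)
  then have "x [^] r \<otimes> inv y \<in> U"
    using i subgroup_int_pow_closed[OF sU m(2)] subgroup.m_closed[OF sU] by simp
  then show ?thesis using r by blast
qed

text \<open>Translates of a compact open subgroup give local compactness. A connected set through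
  \<open>x\<close> lies in the clopen coset \<open>U #> x\<close> for every open subgroup
  \<open>U\<close>, and these cosets meet only in \<open>x\<close>.\<close>

lemma periodic: "periodic_group G T"
  unfolding periodic_group_def lc_group_def
proof (intro conjI topological Hausdorff ballI compactin_cl_gen)
  show "locally_compact_space T"
    unfolding locally_compact_space_def
  proof
    fix x assume "x \<in> topspace T"
    then have x: "x \<in> carrier G" by simp
    obtain U where U: "open_subgroup G T U" "compactin T U"
      using compact_open_basis[of "carrier G"] openin_topspace[of T] by auto
    have sU: "subgroup U G" "openin T U" using U by (auto simp: open_subgroup_def)
    have "U #> x = (\<lambda>u. u \<otimes> x) ` U" by (auto simp: r_coset_def)
    then have "compactin T (U #> x)" using U x image_compactin continuous_translations(1) by metis
    moreover have "openin T (U #> x)" "x \<in> U #> x"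
      using sU x openin_r_coset rcos_self by auto
    ultimately show "\<exists>V K. openin T V \<and> compactin T K \<and> x \<in> V \<and> V \<subseteq> K" by blast
  qed
  show "totally_disconnected_space T"
    unfolding totally_disconnected_space_def
  proof (intro ballI equalityI subsetI)
    fix x y assume "x \<in> topspace T" "y \<in> connected_component_of_set T x"
    then obtain C where C: "connectedin T C" "x \<in> C" "y \<in> C" and xy: "x \<in> carrier G" "y \<in> carrier G"
      unfolding connected_component_of_def
      using connectedin_subset_topspace by fastforce
    have "y = x"
    proof (rule eq_if_all_open_subgroups)
      fix U assume U: "open_subgroup G T U"
      have "openin T (U #> x)" "closedin T (U #> x)" "x \<in> U #> x"
        using U xy openin_r_coset closedin_r_coset open_subgroup_closedin rcos_self
        by (auto simp: open_subgroup_def)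
      then have "C \<subseteq> U #> x" using C connectedin_clopen_cases[of T C "U #> x"] by (auto simp: disjnt_iff)
      then show "y \<otimes> inv x \<in> U"
        using C xy U by (auto simp: open_subgroup_def mem_r_coset_iff)
    qed (use xy in auto)
    then show "y \<in> {x}" by simp
  qed (auto simp: connected_component_of_refl)
qed

end

lemma td_group_if_periodic:
  assumes "periodic_group G T"
  shows "td_group G T"
proof -
  have tg: "topological_group G T" using assms by (auto simp: periodic_group_def lc_group_def)
  then interpret top_group G T
    by (intro top_group.intro top_group_axioms.intro) (auto simp: topological_group_def)
  show ?thesis
    by unfold_locales (use assms van_Dantzig in \<open>auto simp: periodic_group_def lc_group_def\<close>)
qed

section \<open>Quotient groups and their topology\<close>

lemma openin_quot_top:
  assumes "group G" "subgroup H G"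
  shows "openin (quot_top G T H) U \<longleftrightarrow> U \<subseteq> rcosets\<^bsub>G\<^esub> H \<and> openin T (\<Union>U)"
proof -
  have "istopology (\<lambda>U. U \<subseteq> rcosets\<^bsub>G\<^esub> H \<and> openin T (\<Union>U))"
    unfolding istopology_def
  proof (intro conjI allI impI)
    fix S V assume S: "S \<subseteq> rcosets\<^bsub>G\<^esub> H \<and> openin T (\<Union>S)" and V: "V \<subseteq> rcosets\<^bsub>G\<^esub> H \<and> openin T (\<Union>V)"
    \<comment> \<open>Distinct cosets are disjoint, so union commutes with intersection on families
      of cosets.\<close>
    have "\<Union>(S \<inter> V) = \<Union>S \<inter> \<Union>V"
    proof
      show "\<Union>S \<inter> \<Union>V \<subseteq> \<Union>(S \<inter> V)"
      proof
        fix x assume "x \<in> \<Union>S \<inter> \<Union>V"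
        then obtain a b where ab: "a \<in> S" "b \<in> V" "x \<in> a" "x \<in> b" by blast
        have "pairwise disjnt (rcosets\<^bsub>G\<^esub> H)" using group.rcos_disjoint assms by blast
        then have "a = b" using ab S V unfolding pairwise_def disjnt_def by blast
        then show "x \<in> \<Union>(S \<inter> V)" using ab by blast
      qed
    qed auto
    then show "openin T (\<Union>(S \<inter> V))" using S V openin_Int[of T "\<Union>S" "\<Union>V"] by simp
    show "S \<inter> V \<subseteq> rcosets\<^bsub>G\<^esub> H" using S by blast
  next
    fix K assume K: "\<forall>k \<in> K. k \<subseteq> rcosets\<^bsub>G\<^esub> H \<and> openin T (\<Union>k)"
    then show "\<Union>K \<subseteq> rcosets\<^bsub>G\<^esub> H" by blast
    have "\<Union>(\<Union>K) = \<Union>((\<lambda>k. \<Union>k) ` K)" by blast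
    then show "openin T (\<Union>(\<Union>K))" using K by auto
  qed
  then show ?thesis unfolding quot_top_def by (simp add: topology_inverse')
qed

locale quotient_td_group = td_group +
  fixes N
  assumes normal: "N \<lhd> G" and closed: "closedin T N"
begin

abbreviation "proj \<equiv> (\<lambda>x. N #> x)"
abbreviation "TQ \<equiv> quot_top G T N"

lemma N_subgroup: "subgroup N G" using normal by (simp add: normal_imp_subgroup)

lemma carrier_quot: "carrier (G Mod N) = proj ` carrier G"
  by (simp add: carrier_FactGroup)

lemma openin_TQ: "openin TQ U \<longleftrightarrow> U \<subseteq> carrier (G Mod N) \<and> openin T (\<Union>U)"
  using openin_quot_top[OF _ N_subgroup] by (simp add: FactGroup_def is_group)

lemma Union_eq_preimage:
  assumes "U \<subseteq> carrier (G Mod N)"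
  shows "\<Union>U = {x \<in> carrier G. proj x \<in> U}"
proof
  show "{x \<in> carrier G. proj x \<in> U} \<subseteq> \<Union>U" using rcos_self N_subgroup by blast
  show "\<Union>U \<subseteq> {x \<in> carrier G. proj x \<in> U}"
  proof clarify
    fix x V assume x: "x \<in> V" "V \<in> U"
    then obtain y where y: "y \<in> carrier G" "V = proj y" using assms carrier_quot by blast
    then have "x \<in> carrier G" using x N_subgroup by (meson r_coset_subset_G subgroup.subset subsetD)
    then show "x \<in> carrier G \<and> proj x \<in> U" using x y repr_independence[OF _ y(1) N_subgroup] by metis
  qed
qed

lemma topspace_TQ: "topspace TQ = carrier (G Mod N)"
proof -
  have "openin TQ (carrier (G Mod N))"
    using openin_topspace[of T] by (simp add: openin_TQ Union_eq_preimage Collect_conv_if carrier_quot cong: conj_cong)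
  then show ?thesis using openin_TQ openin_subset openin_topspace by (metis subset_antisym)
qed

lemma continuous_proj: "continuous_map T TQ proj"
  unfolding continuous_map by (auto simp: topspace_TQ carrier_quot openin_TQ Union_eq_preimage)

text \<open>The union of the cosets of elements of \<open>V\<close> is the union of the translates
  of \<open>V\<close> by elements of \<open>N\<close>, which is open.\<close>

lemma open_proj: "open_map T TQ proj"
  unfolding open_map_def openin_TQ
proof (intro allI impI conjI)
  fix V assume V: "openin T V"
  then have sub: "V \<subseteq> carrier G" using openin_subset topspace_eq by metis
  show "proj ` V \<subseteq> carrier (G Mod N)" using sub carrier_quot by blast
  have "\<Union>(proj ` V) = (\<Union>n \<in> N. {x \<in> topspace T. inv n \<otimes> x \<in> V})"
  proof
    show "\<Union>(proj ` V) \<subseteq> (\<Union>n \<in> N. {x \<in> topspace T. inv n \<otimes> x \<in> V})"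
    proof clarify
      fix x v assume v: "v \<in> V" "x \<in> N #> v"
      then obtain n where n: "n \<in> N" "x = n \<otimes> v" by (auto simp: r_coset_def)
      then have "n \<in> carrier G" "v \<in> carrier G" using v sub N_subgroup subgroup.subset by blast+
      then have "inv n \<otimes> x = v" "x \<in> carrier G" using n by (auto simp flip: m_assoc)
      then show "x \<in> (\<Union>n \<in> N. {x \<in> topspace T. inv n \<otimes> x \<in> V})" using n(1) v(1) by (intro UN_I[OF n(1)]) simp
    qed
    show "(\<Union>n \<in> N. {x \<in> topspace T. inv n \<otimes> x \<in> V}) \<subseteq> \<Union>(proj ` V)"
    proof clarify
      fix x n assume n: "n \<in> N" "inv n \<otimes> x \<in> V" "x \<in> topspace T"
      then have "n \<in> carrier G" "x \<in> carrier G" using N_subgroup subgroup.subset by auto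
      then have "x = n \<otimes> (inv n \<otimes> x)" by (simp flip: m_assoc)
      then have "x \<in> N #> (inv n \<otimes> x)" using n by (auto simp: r_coset_def)
      then show "x \<in> \<Union>(proj ` V)" using n by blast
    qed
  qed
  moreover have "openin T {x \<in> topspace T. inv n \<otimes> x \<in> V}" if "n \<in> N" for n
    using subgroup.mem_carrier[OF N_subgroup that] V
    by (intro openin_continuous_map_preimage[OF continuous_translations(2)]) auto
  ultimately show "openin T (\<Union>(proj ` V))" by auto
qed

lemma proj_quotient_map: "quotient_map T TQ proj"
  using continuous_open_imp_quotient_map[OF continuous_proj open_proj] by (simp add: topspace_TQ carrier_quot)

lemma group_quot: "group (G Mod N)"
  using normal by (rule normal.factorgroup_is_group)

lemma proj_hom: "proj \<in> hom G (G Mod N)"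
  using normal by (rule normal.r_coset_hom_Mod)

lemma proj_mult: "x \<in> carrier G \<Longrightarrow> y \<in> carrier G \<Longrightarrow> proj x \<otimes>\<^bsub>G Mod N\<^esub> proj y = proj (x \<otimes> y)"
  using hom_mult[OF proj_hom] by simp

lemma group_hom_proj: "group_hom G (G Mod N) proj"
  using group_quot proj_hom by (simp add: group_hom_def group_hom_axioms_def is_group)

lemma proj_inv: "x \<in> carrier G \<Longrightarrow> inv\<^bsub>G Mod N\<^esub> (proj x) = proj (inv x)"
  using group_hom.hom_inv[OF group_hom_proj] by simp

lemma proj_eq_iff: "x \<in> carrier G \<Longrightarrow> y \<in> carrier G \<Longrightarrow> proj x = proj y \<longleftrightarrow> x \<otimes> inv y \<in> N"
  using repr_independence[of x N y, OF _ _ N_subgroup] rcos_self[OF _ N_subgroup, of x]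
    mem_r_coset_iff[OF N_subgroup, of y x] by blast

text \<open>For multiplication, a product neighbourhood is found in \<open>G\<close> and projected
  by the open map \<open>proj\<close>. Inversion descends because \<open>proj\<close> is a quotient
  map.\<close>

lemma top_group_quot: "topological_group (G Mod N) TQ"
  unfolding topological_group_def
proof (intro conjI group_quot topspace_TQ)
  show "continuous_map (prod_topology TQ TQ) TQ (\<lambda>(x, y). x \<otimes>\<^bsub>G Mod N\<^esub> y)"
    unfolding continuous_map
  proof (intro conjI allI impI)
    show "(\<lambda>(x, y). x \<otimes>\<^bsub>G Mod N\<^esub> y) ` topspace (prod_topology TQ TQ) \<subseteq> topspace TQ"
      unfolding topspace_prod_topology topspace_TQ
      using monoid.m_closed[OF group.is_monoid[OF group_quot]] by (intro image_subsetI) force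
    fix W assume W: "openin TQ W"
    let ?P = "{z \<in> topspace (prod_topology TQ TQ). (case z of (x, y) \<Rightarrow> x \<otimes>\<^bsub>G Mod N\<^esub> y) \<in> W}"
    have Wo: "openin T (\<Union>W)" "\<Union>W = {x \<in> carrier G. proj x \<in> W}"
      using W openin_TQ Union_eq_preimage by auto
    show "openin (prod_topology TQ TQ) ?P"
      unfolding openin_prod_topology_alt
    proof (intro allI impI)
      fix a b assume "(a, b) \<in> ?P"
      then have ab: "a \<in> carrier (G Mod N)" "b \<in> carrier (G Mod N)" "a \<otimes>\<^bsub>G Mod N\<^esub> b \<in> W"
        by (auto simp: topspace_TQ)
      then obtain x y where xy: "x \<in> carrier G" "y \<in> carrier G" "a = proj x" "b = proj y"
        using carrier_quot by auto
      have "openin (prod_topology T T) {z \<in> topspace (prod_topology T T). (case z of (x, y) \<Rightarrow> x \<otimes> y) \<in> \<Union>W}"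
        (is "openin _ ?R")
        using topological Wo openin_continuous_map_preimage unfolding topological_group_def by blast
      moreover have "(x, y) \<in> ?R"
        using xy ab Wo(2) proj_mult by auto
      ultimately obtain U V where UV: "openin T U" "openin T V" "x \<in> U" "y \<in> V" "U \<times> V \<subseteq> ?R"
        unfolding openin_prod_topology_alt by meson
      have "proj ` U \<times> proj ` V \<subseteq> ?P"
      proof
        fix c assume "c \<in> proj ` U \<times> proj ` V"
        then obtain u v where uv: "u \<in> U" "v \<in> V" "c = (proj u, proj v)" by auto
        then have "(u, v) \<in> ?R" using UV by blast
        then have "u \<in> carrier G" "v \<in> carrier G" "u \<otimes> v \<in> \<Union>W" by auto
        then have "u \<in> carrier G" "v \<in> carrier G" "proj (u \<otimes> v) \<in> W" unfolding Wo(2) by auto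
        then show "c \<in> ?P"
          using uv(3) carrier_quot proj_mult by (simp add: topspace_TQ)
      qed
      moreover have "openin TQ (proj ` U)" "openin TQ (proj ` V)"
        using UV open_proj by (auto simp: open_map_def)
      ultimately show "\<exists>U V. openin TQ U \<and> openin TQ V \<and> a \<in> U \<and> b \<in> V \<and> U \<times> V \<subseteq> ?P"
        unfolding xy(3,4) using UV(3,4) by (intro exI[of _ "proj ` U"] exI[of _ "proj ` V"]) simp
    qed
  qed
  have "continuous_map T TQ (proj \<circ> (\<lambda>x. inv x))"
    using topological continuous_map_compose continuous_proj unfolding topological_group_def by blast
  then have "continuous_map T TQ ((\<lambda>a. inv\<^bsub>G Mod N\<^esub> a) \<circ> proj)"
    by (rule continuous_map_eq) (simp add: proj_inv)
  then show "continuous_map TQ TQ (\<lambda>a. inv\<^bsub>G Mod N\<^esub> a)"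
    using continuous_compose_quotient_map[OF proj_quotient_map] by blast
qed

lemma top_group_axioms_quot: "top_group (G Mod N) TQ"
  using top_group_quot group_quot by (simp add: top_group_def top_group_axioms_def)

text \<open>Since \<open>z = x \<otimes> inv y\<close> lies outside the closed set \<open>N\<close>,
  some open subgroup \<open>U\<close> has \<open>U #> z\<close> disjoint from \<open>N\<close>. A
  common image of \<open>u \<otimes> x\<close> and \<open>v \<otimes> y\<close> with
  \<open>u\<close> and \<open>v\<close> in \<open>U\<close> would put
  \<open>inv v \<otimes> u \<otimes> z\<close> into \<open>N\<close>.\<close>

lemma Hausdorff_quot: "Hausdorff_space TQ"
  unfolding Hausdorff_space_def
proof (intro allI impI)
  fix a b assume "a \<in> topspace TQ \<and> b \<in> topspace TQ \<and> a \<noteq> b"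
  then obtain x y where xy: "x \<in> carrier G" "y \<in> carrier G" "a = proj x" "b = proj y" "proj x \<noteq> proj y"
    unfolding topspace_TQ carrier_quot by auto
  define z where "z = x \<otimes> inv y"
  have z: "z \<in> carrier G" "z \<notin> N" using xy proj_eq_iff by (auto simp: z_def)
  have "openin T {w \<in> topspace T. w \<otimes> z \<in> topspace T - N}"
    using closed by (intro openin_continuous_map_preimage[OF continuous_translations(1)] z openin_diff openin_topspace)
  then obtain U where U: "open_subgroup G T U" "U \<subseteq> {w \<in> topspace T. w \<otimes> z \<in> topspace T - N}"
    using compact_open_basis z by (metis (no_types, lifting) DiffI l_one mem_Collect_eq one_closed topspace_eq)
  have sU: "subgroup U G" "openin T U" using U by (auto simp: open_subgroup_def)
  have Uc: "U \<subseteq> carrier G" using sU subgroup.subset by blast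
  have "openin TQ (proj ` (U #> x))" "openin TQ (proj ` (U #> y))"
    using open_proj sU openin_r_coset xy by (auto simp: open_map_def)
  moreover have "a \<in> proj ` (U #> x)" "b \<in> proj ` (U #> y)" using xy rcos_self sU by auto
  moreover have "disjnt (proj ` (U #> x)) (proj ` (U #> y))"
  proof (rule ccontr)
    assume "\<not> ?thesis"
    then obtain u v where uv: "u \<in> U" "v \<in> U" "proj (u \<otimes> x) = proj (v \<otimes> y)"
      by (auto simp: disjnt_iff r_coset_def)
    have c: "u \<in> carrier G" "v \<in> carrier G" using uv Uc by auto
    have "proj (inv v \<otimes> u \<otimes> z) = proj (inv v) \<otimes>\<^bsub>G Mod N\<^esub> proj (u \<otimes> x) \<otimes>\<^bsub>G Mod N\<^esub> proj (inv y)"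
      using c xy by (simp add: proj_mult z_def m_assoc del: mult_FactGroup)
    also have "\<dots> = proj (inv v \<otimes> v)"
      unfolding uv using c xy by (simp add: proj_mult m_assoc del: mult_FactGroup)
    finally have "proj (inv v \<otimes> u \<otimes> z) = proj \<one>" using c by simp
    then have "inv v \<otimes> u \<otimes> z \<in> N" using c z proj_eq_iff[of "inv v \<otimes> u \<otimes> z" \<one>] by simp
    moreover have "inv v \<otimes> u \<in> U" using uv sU by (simp add: subgroup.m_closed subgroup.m_inv_closed)
    ultimately show False using U by blast
  qed
  ultimately show "\<exists>U V. openin TQ U \<and> openin TQ V \<and> a \<in> U \<and> b \<in> V \<and> disjnt U V" by blast
qed

lemma td_group_quot: "td_group (G Mod N) TQ"
proof -
  interpret Q: top_group "G Mod N" TQ by (rule top_group_axioms_quot)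
  interpret h: group_hom G "G Mod N" proj by (rule group_hom_proj)
  show ?thesis
  proof
    show "Hausdorff_space TQ" by (rule Hausdorff_quot)
    fix W assume W: "openin TQ W" "\<one>\<^bsub>G Mod N\<^esub> \<in> W"
    have "openin T {x \<in> topspace T. proj x \<in> W}"
      using continuous_proj W openin_continuous_map_preimage by blast
    moreover have "\<one> \<in> {x \<in> topspace T. proj x \<in> W}" using W h.hom_one by simp
    ultimately obtain U where U: "open_subgroup G T U" "compactin T U" "U \<subseteq> {x \<in> topspace T. proj x \<in> W}"
      using compact_open_basis by blast
    have "open_subgroup (G Mod N) TQ (proj ` U)"
      using U open_proj h.subgroup_img_is_subgroup by (auto simp: open_subgroup_def open_map_def)
    moreover have "compactin TQ (proj ` U)" using U continuous_proj image_compactin by blast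
    ultimately show "\<exists>U. open_subgroup (G Mod N) TQ U \<and> compactin TQ U \<and> U \<subseteq> W"
      using U(3) by blast
  next
    fix a assume "a \<in> carrier (G Mod N)"
    then obtain g where g: "g \<in> carrier G" "a = proj g" using carrier_quot by blast
    have sub: "subgroup (cl_gen G T {g}) G" using g cl_gen_subgroup by simp
    \<comment> \<open>The group topologically generated by \<open>a\<close> lies inside the image of
      a compact group, which is closed because the quotient is Hausdorff.\<close>
    have cpt: "compactin TQ (proj ` cl_gen G T {g})"
      using image_compactin compactin_cl_gen g continuous_proj by blast
    then have "closedin TQ (proj ` cl_gen G T {g})" using compactin_imp_closedin Hausdorff_quot by blast
    moreover have "subgroup (proj ` cl_gen G T {g}) (G Mod N)" using sub h.subgroup_img_is_subgroup by blast
    moreover have "{a} \<subseteq> proj ` cl_gen G T {g}" using g cl_gen_incl[of "{g}"] by simp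
    ultimately have "cl_gen (G Mod N) TQ {a} \<subseteq> proj ` cl_gen G T {g}" using Q.cl_gen_minimal by blast
    then show "compactin TQ (cl_gen (G Mod N) TQ {a})"
      using closed_compactin[OF cpt] Q.closedin_cl_gen by blast
  qed
qed

end

section \<open>Primary components of periodic abelian groups\<close>

locale td_comm_group = td_group G T + comm_group G for G (structure) and T
begin

text \<open>Congruence modulo \<open>U\<close> is written \<open>a \<otimes> inv b \<in> U\<close>.
  This and the next lemmas form its calculus; powers respect it because the group is
  commutative.\<close>

lemma cong_sym:
  assumes "subgroup U G" "a \<in> carrier G" "b \<in> carrier G" "a \<otimes> inv b \<in> U"
  shows "b \<otimes> inv a \<in> U"
  using subgroup.m_inv_closed[OF assms(1,4)] assms(2,3) by (simp add: inv_mult m_comm)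

lemma cong_trans:
  assumes "subgroup U G" "a \<in> carrier G" "b \<in> carrier G" "c \<in> carrier G"
    "a \<otimes> inv b \<in> U" "b \<otimes> inv c \<in> U"
  shows "a \<otimes> inv c \<in> U"
proof -
  have "(a \<otimes> inv b) \<otimes> (b \<otimes> inv c) = a \<otimes> (inv b \<otimes> b) \<otimes> inv c"
    using assms(2-4) by (simp only: m_assoc m_closed inv_closed)
  then show ?thesis using subgroup.m_closed[OF assms(1,5,6)] assms(2-4) by simp
qed

lemma cong_int_pow:
  assumes "subgroup U G" "a \<in> carrier G" "b \<in> carrier G" "a \<otimes> inv b \<in> U"
  shows "a [^] (i::int) \<otimes> inv (b [^] i) \<in> U"
  using subgroup_int_pow_closed[OF assms(1,4), of i] assms(2,3)
  by (simp add: int_pow_distrib int_pow_inv)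

lemma cong_nat_pow:
  assumes "subgroup U G" "a \<in> carrier G" "b \<in> carrier G" "a \<otimes> inv b \<in> U"
  shows "a [^] (i::nat) \<otimes> inv (b [^] i) \<in> U"
  using cong_int_pow[OF assms, of "int i"] by (simp add: int_pow_int)

lemma cong_mem:
  assumes "subgroup U G" "a \<in> carrier G" "b \<in> carrier G" "a \<otimes> inv b \<in> U" "b \<in> U"
  shows "a \<in> U"
  using subgroup.m_closed[OF assms(1,4,5)] assms(2,3) by (simp add: m_assoc)

text \<open>Each set of solutions of \<open>P U\<close> is a union of cosets of \<open>U\<close>, hence closed, so the finite
  intersection property applies.\<close>

lemma compact_choice:
  assumes K: "compactin T K"
    and ex: "\<And>U. open_subgroup G T U \<Longrightarrow> \<exists>u \<in> K. P U u"
    and mono: "\<And>U V u. open_subgroup G T U \<Longrightarrow> open_subgroup G T V \<Longrightarrow> U \<subseteq> V \<Longrightarrow> P U u \<Longrightarrow> P V u"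
    and coset: "\<And>U u v. open_subgroup G T U \<Longrightarrow> u \<in> carrier G \<Longrightarrow> v \<in> carrier G \<Longrightarrow>
      P U u \<Longrightarrow> v \<otimes> inv u \<in> U \<Longrightarrow> P U v"
  shows "\<exists>u \<in> K. \<forall>U. open_subgroup G T U \<longrightarrow> P U u"
proof -
  define F where "F = (\<lambda>U. {u \<in> carrier G. P U u})"
  have Kc: "K \<subseteq> carrier G" using K compactin_subset_topspace topspace_eq by metis
  have clo: "closedin T (F U)" if U: "open_subgroup G T U" for U
  proof -
    have sU: "subgroup U G" "openin T U" using U by (auto simp: open_subgroup_def)
    have "openin T (topspace T - F U)"
    proof (subst openin_subopen, rule ballI)
      fix x assume x: "x \<in> topspace T - F U"
      have "U #> x \<subseteq> topspace T - F U"
      proof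
        fix v assume "v \<in> U #> x"
        then have v: "v \<in> carrier G" "v \<otimes> inv x \<in> U" using x mem_r_coset_iff[OF sU(1)] by auto
        then have "x \<otimes> inv v \<in> U" using cong_sym sU x by simp
        then have "\<not> P U v" using coset[OF U v(1)] x by (auto simp: F_def)
        then show "v \<in> topspace T - F U" using v by (auto simp: F_def)
      qed
      then show "\<exists>V. openin T V \<and> x \<in> V \<and> V \<subseteq> topspace T - F U"
        using openin_r_coset[OF sU(2)] rcos_self[OF _ sU(1)] x by (metis DiffD1 topspace_eq)
    qed
    then show ?thesis by (auto simp: closedin_def F_def)
  qed
  \<comment> \<open>The factor \<open>carrier G\<close> accounts for the empty family, whose
    intersection is the whole type.\<close>
  have fin: "open_subgroup G T (carrier G \<inter> \<Inter>\<U>)"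
    if "finite \<U>" "\<forall>U \<in> \<U>. open_subgroup G T U" for \<U>
    using that
  proof (induction \<U> rule: finite_induct)
    case empty
    then show ?case using subgroup_self openin_topspace[of T] by (simp add: open_subgroup_def)
  next
    case (insert U \<U>)
    have "carrier G \<inter> \<Inter>(insert U \<U>) = U \<inter> (carrier G \<inter> \<Inter>\<U>)" by blast
    then show ?case using insert open_subgroup_Int by simp
  qed
  have "K \<inter> \<Inter>(F ` {U. open_subgroup G T U}) \<noteq> {}"
  proof -
    have "K \<inter> \<Inter>\<F> \<noteq> {}" if \<F>: "finite \<F>" "\<F> \<subseteq> F ` {U. open_subgroup G T U}" for \<F>
    proof -
      obtain \<U> where \<U>: "finite \<U>" "\<U> \<subseteq> {U. open_subgroup G T U}" "\<F> = F ` \<U>"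
        using finite_subset_image[OF \<F>] by blast
      \<comment> \<open>By monotonicity, a witness for the intersection serves all the finitely many
        given subgroups.\<close>
      let ?V = "carrier G \<inter> \<Inter>\<U>"
      have V: "open_subgroup G T ?V" using fin[of \<U>] \<U> by blast
      obtain u where u: "u \<in> K" "P ?V u" using ex V by blast
      have "u \<in> F U" if "U \<in> \<U>" for U
        using that mono[OF V, of U u] u \<U> Kc by (auto simp: F_def)
      then show ?thesis using u \<U> by blast
    qed
    moreover have "\<forall>C \<in> F ` {U. open_subgroup G T U}. closedin T C" using clo by blast
    ultimately show ?thesis using K unfolding compactin_fip by blast
  qed
  then show ?thesis by (auto simp: F_def)
qed

text \<open>Compactness turns roots modulo each open subgroup into an exact root.\<close>

lemma cl_gen_root:
  assumes "z \<in> carrier G" "x \<in> carrier G"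
    and ex: "\<And>U. open_subgroup G T U \<Longrightarrow> \<exists>w \<in> cl_gen G T {z}. w [^] (n::nat) \<otimes> inv x \<in> U"
  shows "\<exists>w \<in> cl_gen G T {z}. w [^] n = x"
proof -
  have sub: "cl_gen G T {z} \<subseteq> carrier G" using cl_gen_subgroup[of "{z}"] assms(1) subgroup.subset by fastforce
  have "\<exists>w \<in> cl_gen G T {z}. \<forall>U. open_subgroup G T U \<longrightarrow> w [^] n \<otimes> inv x \<in> U"
  proof (rule compact_choice[OF compactin_cl_gen[OF assms(1)]])
    fix U u v assume U: "open_subgroup G T U" and uv: "u \<in> carrier G" "v \<in> carrier G"
      "u [^] n \<otimes> inv x \<in> U" "v \<otimes> inv u \<in> U"
    then have sU: "subgroup U G" by (simp add: open_subgroup_def)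
    show "v [^] n \<otimes> inv x \<in> U"
      using cong_trans[OF sU, of "v [^] n" "u [^] n" x] cong_nat_pow[OF sU, of v u n] uv assms(2) by simp
  qed (use ex in auto)
  then obtain w where w: "w \<in> cl_gen G T {z}" "\<And>U. open_subgroup G T U \<Longrightarrow> w [^] n \<otimes> inv x \<in> U" by blast
  have "w [^] n = x"
    using eq_if_all_open_subgroups[OF _ assms(2), of "w [^] n"] w sub by auto
  then show ?thesis using w by blast
qed

section \<open>Torsion modulo open subgroups and primary parts\<close>

definition torsion_modulo :: "nat set \<Rightarrow> 'a set" where
  "torsion_modulo M = {x \<in> carrier G. \<forall>U. open_subgroup G T U \<longrightarrow> (\<exists>m \<in> M. x [^] m \<in> U)}"

lemma torsion_modulo_mono: "M \<subseteq> M' \<Longrightarrow> torsion_modulo M \<subseteq> torsion_modulo M'"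
  unfolding torsion_modulo_def by blast

lemma torsion_modulo_subgroup:
  assumes "1 \<in> M" "\<And>m n. m \<in> M \<Longrightarrow> n \<in> M \<Longrightarrow> m * n \<in> M"
  shows "subgroup (torsion_modulo M) G"
proof
  show "torsion_modulo M \<subseteq> carrier G" by (auto simp: torsion_modulo_def)
  show "\<one> \<in> torsion_modulo M" using assms(1)
    by (auto simp: torsion_modulo_def open_subgroup_def subgroup.one_closed)
  fix x assume x: "x \<in> torsion_modulo M"
  then have xc: "x \<in> carrier G" by (simp add: torsion_modulo_def)
  show "inv x \<in> torsion_modulo M"
    using x xc by (auto simp: torsion_modulo_def open_subgroup_def nat_pow_inv intro: subgroup.m_inv_closed)
  fix y assume y: "y \<in> torsion_modulo M"
  then have yc: "y \<in> carrier G" by (simp add: torsion_modulo_def)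
  show "x \<otimes> y \<in> torsion_modulo M"
    unfolding torsion_modulo_def
  proof (intro CollectI conjI allI impI)
    fix U assume U: "open_subgroup G T U"
    then have sU: "subgroup U G" by (simp add: open_subgroup_def)
    obtain m n where mn: "m \<in> M" "n \<in> M" "x [^] m \<in> U" "y [^] n \<in> U"
      using x y U unfolding torsion_modulo_def by blast
    have "(x \<otimes> y) [^] (m * n) = (x [^] m) [^] n \<otimes> (y [^] n) [^] m"
      using xc yc by (simp add: nat_pow_distrib nat_pow_pow mult.commute)
    also have "\<dots> \<in> U"
      using mn sU by (simp add: subgroup_nat_pow_closed subgroup.m_closed)
    finally show "\<exists>m \<in> M. (x \<otimes> y) [^] m \<in> U" using mn assms(2) by blast
  qed (use xc yc in simp)
qed

text \<open>Congruent elements have congruent powers, so an exponent that works modulo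
  \<open>U\<close> for a nearby element works for \<open>x\<close>.\<close>

lemma torsion_modulo_closed: "closedin T (torsion_modulo M)"
proof -
  have "T closure_of (torsion_modulo M) \<subseteq> torsion_modulo M"
  proof
    fix x assume x: "x \<in> T closure_of (torsion_modulo M)"
    then have xc: "x \<in> carrier G" by (simp add: in_closure_of)
    have sub: "torsion_modulo M \<subseteq> carrier G" by (auto simp: torsion_modulo_def)
    show "x \<in> torsion_modulo M"
      unfolding torsion_modulo_def
    proof (intro CollectI conjI allI impI xc)
      fix U assume U: "open_subgroup G T U"
      then have sU: "subgroup U G" by (simp add: open_subgroup_def)
      obtain s where s: "s \<in> torsion_modulo M" "s \<otimes> inv x \<in> U"
        using x U in_closure_of_iff[OF sub xc] by blast
      have sc: "s \<in> carrier G" using s sub by blast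
      obtain m where m: "m \<in> M" "s [^] m \<in> U" using s U by (auto simp: torsion_modulo_def)
      have "x [^] m \<in> U"
        using cong_mem[OF sU _ _ cong_nat_pow[OF sU xc sc cong_sym[OF sU sc xc s(2)]] m(2)] xc sc by simp
      then show "\<exists>m \<in> M. x [^] m \<in> U" using m by blast
    qed
  qed
  then show ?thesis by (auto simp: torsion_modulo_def simp flip: closure_of_subset_eq)
qed

text \<open>If \<open>x [^] m \<in> U\<close> and \<open>a * m + b * n = 1\<close>, then
  \<open>x\<close> is congruent to \<open>(x [^] b) [^] n\<close> modulo \<open>U\<close>;
  \<open>cl_gen_root\<close> makes the root exact.\<close>

lemma torsion_modulo_root:
  assumes x: "x \<in> torsion_modulo M" and cop: "\<And>m. m \<in> M \<Longrightarrow> coprime m n"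
  shows "\<exists>w \<in> cl_gen G T {x}. w [^] n = x"
proof -
  have xc: "x \<in> carrier G" using x by (simp add: torsion_modulo_def)
  have sC: "subgroup (cl_gen G T {x}) G" "x \<in> cl_gen G T {x}"
    using cl_gen_subgroup cl_gen_incl[of "{x}"] xc by auto
  show ?thesis
  proof (rule cl_gen_root[OF xc xc])
    fix U assume U: "open_subgroup G T U"
    then have sU: "subgroup U G" by (simp add: open_subgroup_def)
    obtain m where m: "m \<in> M" "x [^] m \<in> U" using x U by (auto simp: torsion_modulo_def)
    obtain a b :: int where ab: "a * int m + b * int n = 1"
      using cop[OF m(1)] bezout_int[of "int m" "int n"] by auto
    have "(x [^] b) [^] n \<otimes> inv x = x [^] (b * int n - 1)"
      using xc by (simp add: int_pow_diff int_pow_pow flip: int_pow_int)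
    also have "b * int n - 1 = int m * (- a)" using ab by (simp add: algebra_simps)
    also have "x [^] (int m * (- a)) = (x [^] m) [^] (- a)" using xc by (simp add: int_pow_pow flip: int_pow_int)
    also have "\<dots> \<in> U" using subgroup_int_pow_closed[OF sU m(2)] .
    finally show "\<exists>w \<in> cl_gen G T {x}. w [^] n \<otimes> inv x \<in> U"
      using subgroup_int_pow_closed[OF sC] by blast
  qed
qed

text \<open>For prime \<open>p\<close>, \<open>primary_component_eq\<close> identifies this with the
  \<open>p\<close>-primary component. The present form avoids the topology of the group generated by
  the element.\<close>

definition p_part :: "nat \<Rightarrow> 'a set" where
  "p_part p = torsion_modulo (range (\<lambda>k. p ^ k))"

definition coprime_part :: "nat \<Rightarrow> 'a set" where
  "coprime_part p = torsion_modulo {m. coprime m p}"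

lemma p_part_iff:
  "x \<in> p_part p \<longleftrightarrow> x \<in> carrier G \<and> (\<forall>U. open_subgroup G T U \<longrightarrow> (\<exists>k. x [^] (p ^ k) \<in> U))"
  by (auto simp: p_part_def torsion_modulo_def)

lemma p_part_subgroup: "subgroup (p_part p) G"
  unfolding p_part_def
proof (rule torsion_modulo_subgroup)
  show "1 \<in> range (\<lambda>k. p ^ k)" by (metis power_0 rangeI)
  show "m * n \<in> range (\<lambda>k. p ^ k)" if "m \<in> range (\<lambda>k. p ^ k)" "n \<in> range (\<lambda>k. p ^ k)" for m n
    using that by (auto simp flip: power_add)
qed

lemma coprime_part_subgroup: "subgroup (coprime_part p) G"
  unfolding coprime_part_def by (rule torsion_modulo_subgroup) auto

lemma p_part_closed: "closedin T (p_part p)"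
  unfolding p_part_def by (rule torsion_modulo_closed)

lemma coprime_part_closed: "closedin T (coprime_part p)"
  unfolding coprime_part_def by (rule torsion_modulo_closed)

lemma p_part_subset_coprime_part:
  assumes "Factorial_Ring.prime p" "Factorial_Ring.prime q" "p \<noteq> q"
  shows "p_part q \<subseteq> coprime_part p"
  unfolding p_part_def coprime_part_def
  using primes_coprime[OF assms(2,1)] assms(3) by (intro torsion_modulo_mono) auto

lemma p_part_root:
  assumes "x \<in> p_part p" "coprime n p"
  shows "\<exists>w \<in> p_part p. w [^] n = x"
proof -
  have "cl_gen G T {x} \<subseteq> p_part p" using cl_gen_minimal p_part_subgroup p_part_closed assms(1) by simp
  moreover have "\<exists>w \<in> cl_gen G T {x}. w [^] n = x"
    using assms by (intro torsion_modulo_root[of x "range (\<lambda>k. p ^ k)"]) (auto simp: p_part_def coprime_commute)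
  ultimately show ?thesis by blast
qed

text \<open>Some \<open>y [^] n\<close> lies in \<open>U\<close>, with \<open>n = q * m\<close>,
  \<open>q\<close> a power of \<open>p\<close> and \<open>m\<close> prime to \<open>p\<close>, so
  \<open>y\<close> splits modulo \<open>U\<close> as in the Chinese remainder theorem. Compactness
  yields one splitting for all \<open>U\<close>.\<close>

lemma primary_decomposition:
  assumes p: "Factorial_Ring.prime p" and y: "y \<in> carrier G"
  shows "\<exists>u \<in> cl_gen G T {y}. u \<in> p_part p \<and> y \<otimes> inv u \<in> coprime_part p"
proof -
  have sC: "subgroup (cl_gen G T {y}) G" "y \<in> cl_gen G T {y}"
    using cl_gen_subgroup cl_gen_incl[of "{y}"] y by auto
  have sub: "cl_gen G T {y} \<subseteq> carrier G" using sC subgroup.subset by blast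
  have "\<exists>u \<in> cl_gen G T {y}. \<forall>U. open_subgroup G T U \<longrightarrow>
    (\<exists>k. u [^] (p ^ k) \<in> U) \<and> (\<exists>m. coprime m p \<and> (y \<otimes> inv u) [^] m \<in> U)"
  proof (rule compact_choice[OF compactin_cl_gen[OF y]])
    fix U assume U: "open_subgroup G T U"
    then have sU: "subgroup U G" by (simp add: open_subgroup_def)
    obtain n where n: "0 < n" "y [^] (n::nat) \<in> U" using pow_in_open_subgroup y U by blast
    obtain m where m: "n = p ^ multiplicity p n * m" "\<not> p dvd m"
      using n p multiplicity_decompose'[of n p] prime_elem_not_unit by (metis not_prime_unit less_numeral_extra(3))
    define q where "q = p ^ multiplicity p n"
    have cop: "coprime m p" using m p prime_imp_coprime coprime_commute by metis
    then have "coprime q m" by (simp add: q_def coprime_commute)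
    then obtain a b :: int where ab: "a * int q + b * int m = 1"
      using bezout_int[of "int q" "int m"] by auto
    \<comment> \<open>The exponent \<open>b * m\<close> is divisible by \<open>m\<close> and
      congruent to \<open>1\<close> modulo \<open>q\<close>, so \<open>u\<close> carries the
      \<open>p\<close>-component and \<open>y \<otimes> inv u\<close> the rest.\<close>
    define u where "u = y [^] (b * int m)"
    have uc: "u \<in> carrier G" using y by (simp add: u_def)
    have yn: "y [^] (int n * i) \<in> U" for i :: int
      using subgroup_int_pow_closed[OF sU n(2), of i] y by (simp add: int_pow_pow flip: int_pow_int)
    have nq: "int n = int q * int m" by (subst m(1)) (simp add: q_def)
    have "u [^] q = y [^] (int n * b)"
      using y by (simp add: u_def int_pow_pow nq mult.commute mult.left_commute flip: int_pow_int)
    then have 1: "u [^] q \<in> U" using yn by simp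
    have "y \<otimes> inv u = y [^] (1 - b * int m)" using y by (simp add: u_def int_pow_diff)
    also have "1 - b * int m = a * int q" using ab by simp
    finally have "(y \<otimes> inv u) [^] m = y [^] (int n * a)"
      using y by (simp add: int_pow_pow nq mult.commute mult.left_commute flip: int_pow_int)
    then have 2: "(y \<otimes> inv u) [^] m \<in> U" using yn by simp
    have "u \<in> cl_gen G T {y}" unfolding u_def using subgroup_int_pow_closed[OF sC] .
    then show "\<exists>u \<in> cl_gen G T {y}. (\<exists>k. u [^] (p ^ k) \<in> U) \<and> (\<exists>m. coprime m p \<and> (y \<otimes> inv u) [^] m \<in> U)"
      using 1 2 cop unfolding q_def by blast
  next
    fix U u v assume U: "open_subgroup G T U" and uv: "u \<in> carrier G" "v \<in> carrier G" "v \<otimes> inv u \<in> U"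
      and "(\<exists>k. u [^] (p ^ k) \<in> U) \<and> (\<exists>m. coprime m p \<and> (y \<otimes> inv u) [^] m \<in> U)"
    then obtain k m where km: "u [^] (p ^ k) \<in> U" "coprime m p" "(y \<otimes> inv u) [^] m \<in> U" by blast
    have sU: "subgroup U G" using U by (simp add: open_subgroup_def)
    have "v [^] (p ^ k) \<in> U" using cong_mem[OF sU _ _ cong_nat_pow[OF sU uv(2,1,3)] km(1)] uv by simp
    moreover have "(y \<otimes> inv v) \<otimes> inv (y \<otimes> inv u) = u \<otimes> inv v"
      using uv y by (simp add: inv_mult m_ac(1,2)) (metis inv_closed m_assoc m_comm m_lcomm r_inv r_one)
    then have "(y \<otimes> inv v) \<otimes> inv (y \<otimes> inv u) \<in> U" using cong_sym[OF sU uv(2,1,3)] by simp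
    then have "(y \<otimes> inv v) [^] m \<in> U"
      using cong_mem[OF sU _ _ cong_nat_pow[OF sU, of "y \<otimes> inv v" "y \<otimes> inv u"] km(3)] uv y by simp
    ultimately show "(\<exists>k. v [^] (p ^ k) \<in> U) \<and> (\<exists>m. coprime m p \<and> (y \<otimes> inv v) [^] m \<in> U)"
      using km by blast
  qed blast
  then obtain u where u: "u \<in> cl_gen G T {y}" "\<forall>U. open_subgroup G T U \<longrightarrow>
    (\<exists>k. u [^] (p ^ k) \<in> U) \<and> (\<exists>m. coprime m p \<and> (y \<otimes> inv u) [^] m \<in> U)" by blast
  then have "u \<in> p_part p" "y \<otimes> inv u \<in> coprime_part p"
    using subsetD[OF sub u(1)] y by (simp_all add: p_part_def coprime_part_def torsion_modulo_def)
  then show ?thesis using u(1) by blast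
qed

text \<open>Modulo an open subgroup the element \<open>z\<close> has \<open>p\<close>-power order, so an exponent prime to \<open>p\<close> would
  make \<open>x\<close> a generator as well.\<close>

lemma p_part_root_if_not_generator:
  assumes p: "Factorial_Ring.prime p" and z: "z \<in> p_part p" and x: "x \<in> cl_gen G T {z}"
    and notin: "z \<notin> cl_gen G T {x}"
  shows "\<exists>w \<in> cl_gen G T {z}. w [^] p = x"
proof -
  have zc: "z \<in> carrier G" using z by (simp add: p_part_iff)
  have sC: "subgroup (cl_gen G T {z}) G" "z \<in> cl_gen G T {z}"
    using cl_gen_subgroup cl_gen_incl[of "{z}"] zc by auto
  have xc: "x \<in> carrier G" using x sC subgroup.subset by blast
  obtain U0 where U0: "open_subgroup G T U0" "\<And>i::int. x [^] i \<otimes> inv z \<notin> U0"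
    using mem_cl_gen_iff[OF xc zc] notin by blast
  show ?thesis
  proof (rule cl_gen_root[OF zc xc])
    fix U assume U: "open_subgroup G T U"
    \<comment> \<open>The root is wanted modulo \<open>U\<close>, while \<open>U0\<close> witnesses
      that no power of \<open>x\<close> is congruent to \<open>z\<close>; the intersection serves
      both purposes.\<close>
    have V: "open_subgroup G T (U \<inter> U0)" using open_subgroup_Int U U0 by blast
    then have sV: "subgroup (U \<inter> U0) G" by (simp add: open_subgroup_def)
    obtain i :: int where i: "z [^] i \<otimes> inv x \<in> U \<inter> U0" using mem_cl_gen_iff[OF zc xc] x V by blast
    obtain k where k: "z [^] (p ^ k) \<in> U \<inter> U0" using z V by (auto simp: p_part_iff)
    have "int p dvd i"
    proof (rule ccontr)
      assume "\<not> int p dvd i"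
      then have "coprime (int p) i" using p prime_imp_coprime by (metis prime_nat_int_transfer)
      then have "coprime i (int (p ^ k))" by (simp add: coprime_commute)
      then obtain a b where ab: "a * i + b * int (p ^ k) = 1"
        using bezout_int[of i "int (p ^ k)"] by auto
      have "x [^] a \<otimes> inv ((z [^] i) [^] a) \<in> U \<inter> U0"
        using cong_int_pow[OF sV xc _ cong_sym[OF sV _ xc i]] zc by simp
      moreover have "(z [^] i) [^] a \<otimes> inv z \<in> U \<inter> U0"
      proof -
        have "(z [^] i) [^] a \<otimes> inv z = z [^] (i * a - 1)" using zc by (simp add: int_pow_diff int_pow_pow)
        also have "i * a - 1 = int (p ^ k) * (- b)" using ab by (simp add: algebra_simps)
        also have "z [^] (int (p ^ k) * (- b)) = (z [^] (p ^ k)) [^] (- b)"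
          using zc int_pow_pow[OF zc, of "int (p ^ k)" "- b"] unfolding int_pow_int by simp
        finally show ?thesis using subgroup_int_pow_closed[OF sV k] by metis
      qed
      ultimately have "x [^] a \<otimes> inv z \<in> U \<inter> U0"
        using cong_trans[OF sV, of "x [^] a" "(z [^] i) [^] a" z] xc zc by simp
      then show False using U0 by blast
    qed
    then obtain j where j: "i = int p * j" by blast
    have "(z [^] j) [^] p = z [^] i" using zc j by (simp add: int_pow_pow mult.commute flip: int_pow_int)
    then show "\<exists>w \<in> cl_gen G T {z}. w [^] p \<otimes> inv x \<in> U"
      using i subgroup_int_pow_closed[OF sC, of j] by (intro bexI[of _ "z [^] j"]) auto
  qed
qed

text \<open>An \<open>x\<close> without a \<open>p\<close>-th root in \<open>p_part p\<close>
  generates everything. For any \<open>y\<close>, a generator \<open>z\<close> of the group of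
  \<open>x\<close> and \<open>y\<close> lies in \<open>cl_gen G T {x}\<close>, since otherwise
  \<open>p_part_root_if_not_generator\<close> would give a root.\<close>

lemma p_part_monothetic_or_divisible:
  assumes p: "Factorial_Ring.prime p" and ind: "inductively_monothetic G T"
  shows "(\<exists>b \<in> p_part p. p_part p = cl_gen G T {b}) \<or> (\<forall>x \<in> p_part p. \<exists>w \<in> p_part p. w [^] p = x)"
proof (rule disjCI)
  assume "\<not> (\<forall>x \<in> p_part p. \<exists>w \<in> p_part p. w [^] p = x)"
  then obtain x where x: "x \<in> p_part p" "\<And>w. w \<in> p_part p \<Longrightarrow> w [^] p \<noteq> x" by blast
  have sub: "cl_gen G T S \<subseteq> p_part p" if "S \<subseteq> p_part p" for S
    using that cl_gen_minimal p_part_subgroup p_part_closed by blast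
  have pc: "p_part p \<subseteq> carrier G" using p_part_subgroup subgroup.subset by blast
  have "p_part p \<subseteq> cl_gen G T {x}"
  proof
    fix y assume y: "y \<in> p_part p"
    obtain z where z: "z \<in> carrier G" "cl_gen G T {x, y} = cl_gen G T {z}"
      using ind x y pc unfolding inductively_monothetic_def
      by (metis (no_types, lifting) empty_subsetI finite.emptyI finite.insertI insert_subset subsetD)
    have xyz: "x \<in> cl_gen G T {z}" "y \<in> cl_gen G T {z}" "z \<in> cl_gen G T {z}"
      using z cl_gen_incl[of "{x, y}"] cl_gen_incl[of "{z}"] x y pc by auto
    have "cl_gen G T {z} \<subseteq> p_part p" using sub[of "{x, y}"] x y z by auto
    then have "z \<in> cl_gen G T {x}"
      using p_part_root_if_not_generator[OF p _ xyz(1)] x xyz by blast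
    then have "cl_gen G T {z} \<subseteq> cl_gen G T {x}"
      using cl_gen_minimal cl_gen_subgroup[of "{x}"] closedin_cl_gen x pc by blast
    then show "y \<in> cl_gen G T {x}" using xyz by blast
  qed
  then have "p_part p = cl_gen G T {x}" using sub[of "{x}"] x by blast
  then show "\<exists>b \<in> p_part p. p_part p = cl_gen G T {b}" using x by blast
qed

section \<open>The largest divisible subgroup\<close>

definition p_divisible :: "nat \<Rightarrow> bool" where
  "p_divisible p \<longleftrightarrow> (\<forall>x \<in> p_part p. \<exists>w \<in> p_part p. w [^] p = x)"

lemma divisible_subgroupI:
  assumes H: "subgroup H G"
    and root: "\<And>(q::nat) x. Factorial_Ring.prime q \<Longrightarrow> x \<in> H \<Longrightarrow> \<exists>y \<in> H. y [^] q = x"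
  shows "divisible_subgroup G H"
proof -
  have "\<exists>y \<in> H. y [^] n = x" if "x \<in> H" "0 < n" for x and n :: nat
    using that
  proof (induction n arbitrary: x rule: less_induct)
    case (less n)
    show ?case
    proof (cases "n = 1")
      case True
      then show ?thesis using less.prems H subgroup.mem_carrier by fastforce
    next
      case False
      then obtain q where q: "Factorial_Ring.prime q" "q dvd n" using prime_factor_nat by blast
      then obtain m where m: "n = q * m" by blast
      have "m < n" "0 < m" using less.prems m prime_gt_1_nat[OF q(1)] by auto
      obtain y where y: "y \<in> H" "y [^] q = x" using root q less.prems by blast
      obtain z where z: "z \<in> H" "z [^] m = y" using less.IH[OF \<open>m < n\<close> y(1) \<open>0 < m\<close>] by blast
      have "z [^] n = x"
        using z y m H subgroup.mem_carrier[OF H z(1)] nat_pow_pow[of z m q] by (simp add: mult.commute)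
      then show ?thesis using z by blast
    qed
  qed
  then show ?thesis using H by (auto simp: divisible_subgroup_def)
qed

text \<open>\<open>p_divisible p\<close> provides the \<open>p\<close>-th roots, and
  \<open>p_part_root\<close> those for every other prime.\<close>

lemma p_part_divisible_subgroup:
  assumes "Factorial_Ring.prime p" "p_divisible p"
  shows "divisible_subgroup G (p_part p)"
proof (rule divisible_subgroupI[OF p_part_subgroup])
  fix q :: nat and x assume "Factorial_Ring.prime q" "x \<in> p_part p"
  then show "\<exists>y \<in> p_part p. y [^] q = x"
    using assms p_part_root[of x p q] primes_coprime[of q p] by (cases "q = p") (auto simp: p_divisible_def)
qed

text \<open>Lying in \<open>coprime_part p\<close> expresses that the \<open>p\<close>-component
  vanishes. As an intersection of closed subgroups this set is visibly closed, unlike the union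
  defining \<open>largest_divisible_subgroup\<close>.\<close>

definition divisible_part :: "'a set" where
  "divisible_part = {x \<in> carrier G. \<forall>p. Factorial_Ring.prime p \<longrightarrow> \<not> p_divisible p \<longrightarrow> x \<in> coprime_part p}"

lemma divisible_part_subgroup: "subgroup divisible_part G"
proof -
  have "divisible_part = \<Inter>(insert (carrier G) (coprime_part ` {p. Factorial_Ring.prime p \<and> \<not> p_divisible p}))"
    by (auto simp: divisible_part_def)
  moreover have "subgroup (\<Inter>(insert (carrier G) (coprime_part ` {p. Factorial_Ring.prime p \<and> \<not> p_divisible p}))) G"
    by (rule subgroups_Inter) (auto simp: subgroup_self coprime_part_subgroup)
  ultimately show ?thesis by simp
qed

lemma divisible_part_closed: "closedin T divisible_part"
proof -
  have "divisible_part = \<Inter>(insert (topspace T) (coprime_part ` {p. Factorial_Ring.prime p \<and> \<not> p_divisible p}))"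
    by (auto simp: divisible_part_def)
  moreover have "closedin T (\<Inter>(insert (topspace T) (coprime_part ` {p. Factorial_Ring.prime p \<and> \<not> p_divisible p})))"
    by (rule closedin_Inter) (use coprime_part_closed closedin_topspace[of T] in auto)
  ultimately show ?thesis by simp
qed

text \<open>If \<open>p_divisible q\<close> fails, all elements lie in \<open>coprime_part q\<close>
  and have \<open>q\<close>-th roots in the closure of their own powers. Otherwise the
  \<open>q\<close>-component is split off and gets its root in \<open>p_part q\<close>, while the
  other factor is treated as before.\<close>

lemma divisible_part_divisible: "divisible_subgroup G divisible_part"
proof (rule divisible_subgroupI[OF divisible_part_subgroup])
  fix q :: nat and x assume q: "Factorial_Ring.prime q" and x: "x \<in> divisible_part"
  have xc: "x \<in> carrier G" using x by (simp add: divisible_part_def)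
  have sub: "cl_gen G T {y} \<subseteq> divisible_part" if "y \<in> divisible_part" for y
    using cl_gen_minimal[OF divisible_part_subgroup divisible_part_closed, of "{y}"] that by simp
  have coprime_root: "\<exists>w \<in> divisible_part. w [^] q = y" if "y \<in> divisible_part" "y \<in> coprime_part q" for y
    using torsion_modulo_root[of y "{m. coprime m q}" q] that sub unfolding coprime_part_def by blast
  show "\<exists>y \<in> divisible_part. y [^] q = x"
  proof (cases "p_divisible q")
    case False
    then show ?thesis using coprime_root x q by (simp add: divisible_part_def)
  next
    case True
    obtain u where u: "u \<in> cl_gen G T {x}" "u \<in> p_part q" "x \<otimes> inv u \<in> coprime_part q"
      using primary_decomposition[OF q xc] by blast
    have uD: "u \<in> divisible_part" using sub x u by blast
    have uc: "u \<in> carrier G" using u by (simp add: p_part_iff)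
    obtain w where w: "w \<in> p_part q" "w [^] q = u" using True u by (auto simp: p_divisible_def)
    have wc: "w \<in> carrier G" using w by (simp add: p_part_iff)
    \<comment> \<open>Membership constrains only the primes for which \<open>p_divisible\<close>
      fails, and these differ from \<open>q\<close>.\<close>
    have wD: "w \<in> divisible_part"
      using w True p_part_subset_coprime_part[OF _ q] wc by (auto simp: divisible_part_def)
    have "x \<otimes> inv u \<in> divisible_part"
      using x uD divisible_part_subgroup by (simp add: subgroup.m_closed subgroup.m_inv_closed)
    then obtain v where v: "v \<in> divisible_part" "v [^] q = x \<otimes> inv u" using coprime_root u by blast
    have vc: "v \<in> carrier G" using v by (simp add: divisible_part_def)
    have "(v \<otimes> w) [^] q = x"
      using v w vc wc xc uc by (simp add: nat_pow_distrib m_assoc)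
    then show ?thesis using v wD divisible_part_subgroup by (blast intro: subgroup.m_closed)
  qed
qed

text \<open>If \<open>p_divisible p\<close> fails, \<open>p_part p\<close> is generated by some
  \<open>b\<close>, and \<open>b [^] (p ^ j) \<in> U\<close> for some \<open>j\<close>. Write an
  element \<open>x\<close> of a divisible subgroup as a \<open>p ^ j\<close>-th power: the
  \<open>p\<close>-component of the root is killed modulo \<open>U\<close>, so \<open>x\<close> is
  congruent to an element of the closed set \<open>coprime_part p\<close>.\<close>

lemma largest_divisible_subgroup_eq:
  assumes ind: "inductively_monothetic G T"
  shows "largest_divisible_subgroup G = divisible_part"
proof
  show "divisible_part \<subseteq> largest_divisible_subgroup G"
    using divisible_part_divisible by (auto simp: largest_divisible_subgroup_def)
  show "largest_divisible_subgroup G \<subseteq> divisible_part"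
  proof
    fix x assume "x \<in> largest_divisible_subgroup G"
    then obtain H where H: "divisible_subgroup G H" "x \<in> H" by (auto simp: largest_divisible_subgroup_def)
    then have sH: "subgroup H G" by (simp add: divisible_subgroup_def)
    have xc: "x \<in> carrier G" using H sH subgroup.subset by blast
    have "x \<in> coprime_part p" if p: "Factorial_Ring.prime p" "\<not> p_divisible p" for p
    proof -
      obtain b where b: "b \<in> p_part p" "p_part p = cl_gen G T {b}"
        using p_part_monothetic_or_divisible[OF p(1) ind] p(2) unfolding p_divisible_def by blast
      have bc: "b \<in> carrier G" using b(1) by (simp add: p_part_iff)
      have subE: "coprime_part p \<subseteq> carrier G" using coprime_part_subgroup subgroup.subset by blast
      have "x \<in> T closure_of (coprime_part p)"
        unfolding in_closure_of_iff[OF subE xc]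
      proof (intro allI impI)
        fix U assume U: "open_subgroup G T U"
        then have sU: "subgroup U G" by (simp add: open_subgroup_def)
        obtain j where j: "b [^] (p ^ j) \<in> U" using b(1) U by (auto simp: p_part_iff)
        let ?q = "p ^ j"
        have "0 < ?q" using prime_gt_0_nat[OF p(1)] by simp
        then obtain y where y: "y \<in> H" "y [^] ?q = x" using H unfolding divisible_subgroup_def by blast
        have yc: "y \<in> carrier G" using y sH subgroup.subset by blast
        obtain u where u: "u \<in> p_part p" "y \<otimes> inv u \<in> coprime_part p"
          using primary_decomposition[OF p(1) yc] by blast
        have uc: "u \<in> carrier G" using u by (simp add: p_part_iff)
        define s where "s = (y \<otimes> inv u) [^] ?q"
        have s: "s \<in> coprime_part p"
          unfolding s_def using subgroup_nat_pow_closed[OF coprime_part_subgroup u(2)] .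
        have "s \<otimes> inv x = inv (u [^] ?q)"
        proof -
          have "s = y [^] ?q \<otimes> inv (u [^] ?q)"
            using yc uc by (simp add: s_def nat_pow_distrib nat_pow_inv)
          then have "s = inv (u [^] ?q) \<otimes> x" using y xc uc by (simp add: m_comm)
          then show ?thesis using xc uc by (simp add: m_assoc)
        qed
        moreover have "u [^] ?q \<in> U"
        proof -
          obtain i :: int where i: "b [^] i \<otimes> inv u \<in> U" using mem_cl_gen_iff[OF bc uc] u b U by blast
          have "(b [^] i) [^] ?q = (b [^] ?q) [^] i"
            using bc by (simp add: int_pow_pow mult.commute flip: int_pow_int)
          then have "(b [^] i) [^] ?q \<in> U" using subgroup_int_pow_closed[OF sU j] by simp
          then show ?thesis
            using cong_mem[OF sU _ _ cong_nat_pow[OF sU uc _ cong_sym[OF sU _ uc i]]] bc uc by simp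
        qed
        ultimately have "s \<otimes> inv x \<in> U" using subgroup.m_inv_closed[OF sU] by simp
        then show "\<exists>s \<in> coprime_part p. s \<otimes> inv x \<in> U" using s by blast
      qed
      then show ?thesis using coprime_part_closed closure_of_closedin by blast
    qed
    then show "x \<in> divisible_part" using xc by (simp add: divisible_part_def)
  qed
qed

lemma p_part_monothetic_if_reduced:
  assumes p: "Factorial_Ring.prime p" and ind: "inductively_monothetic G T"
    and red: "\<And>H. divisible_subgroup G H \<Longrightarrow> H \<subseteq> {\<one>}"
  shows "\<exists>b \<in> p_part p. p_part p = cl_gen G T {b}"
  using p_part_monothetic_or_divisible[OF p ind]
proof
  assume "\<forall>x \<in> p_part p. \<exists>w \<in> p_part p. w [^] p = x"
  then have "p_part p \<subseteq> {\<one>}" using red p_part_divisible_subgroup[OF p] by (simp add: p_divisible_def)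
  moreover have one: "\<one> \<in> p_part p" using p_part_subgroup subgroup.one_closed by blast
  moreover have "cl_gen G T {\<one>} \<subseteq> p_part p"
    using one cl_gen_minimal p_part_subgroup p_part_closed by simp
  moreover have "\<one> \<in> cl_gen G T {\<one>}" using cl_gen_incl[of "{\<one>}"] by simp
  ultimately show ?thesis by blast
qed

end

section \<open>Monothetic primary components\<close>

context td_comm_group
begin

text \<open>Two coprime exponents send \<open>x\<close> into \<open>U\<close>, so Bezout puts
  \<open>x\<close> itself into every open subgroup.\<close>

lemma p_part_Int_coprime_part:
  assumes "x \<in> p_part p" "x \<in> coprime_part p"
  shows "x = \<one>"
proof (rule eq_if_all_open_subgroups)
  show xc: "x \<in> carrier G" using assms by (simp add: p_part_iff)
  fix U assume U: "open_subgroup G T U"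
  then have sU: "subgroup U G" by (simp add: open_subgroup_def)
  obtain k where k: "x [^] (p ^ k) \<in> U" using assms(1) U by (auto simp: p_part_iff)
  obtain m where m: "coprime m p" "x [^] m \<in> U"
    using assms(2) U by (auto simp: coprime_part_def torsion_modulo_def)
  have "coprime (p ^ k) m" using m by (simp add: coprime_commute)
  then obtain a b :: int where ab: "a * int (p ^ k) + b * int m = 1"
    using bezout_int[of "int (p ^ k)" "int m"] by (auto simp flip: of_nat_power)
  have "(x [^] (p ^ k)) [^] a \<otimes> (x [^] m) [^] b = x [^] (int (p ^ k) * a) \<otimes> x [^] (int m * b)"
    using int_pow_pow[OF xc, of "int (p ^ k)" a] int_pow_pow[OF xc, of "int m" b] by (simp only: int_pow_int)
  also have "\<dots> = x [^] (int (p ^ k) * a + int m * b)" using xc int_pow_mult by metis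
  also have "int (p ^ k) * a + int m * b = 1" using ab by (simp only: mult.commute)
  finally have "x \<in> U"
    using xc subgroup_int_pow_closed[OF sU k, of a] subgroup_int_pow_closed[OF sU m(2), of b]
      subgroup.m_closed[OF sU] by (metis int_pow_1)
  then show "x \<otimes> inv \<one> \<in> U" using xc by simp
qed simp

lemma topological_group_subgroup:
  assumes H: "subgroup H G"
  shows "topological_group (G\<lparr>carrier := H\<rparr>) (subtopology T H)"
  unfolding topological_group_def
proof (intro conjI)
  have Hc: "H \<subseteq> carrier G" using H subgroup.subset by blast
  show "group (G\<lparr>carrier := H\<rparr>)" using subgroup.subgroup_is_group[OF H] is_group by simp
  show "topspace (subtopology T H) = carrier (G\<lparr>carrier := H\<rparr>)" using Hc by auto
  have "continuous_map (subtopology (prod_topology T T) (H \<times> H)) (subtopology T H) (\<lambda>(x, y). x \<otimes> y)"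
    using topological subgroup.m_closed[OF H]
    by (auto simp: topological_group_def continuous_map_in_subtopology continuous_map_from_subtopology)
  then show "continuous_map (prod_topology (subtopology T H) (subtopology T H)) (subtopology T H)
     (\<lambda>(x, y). x \<otimes>\<^bsub>G\<lparr>carrier := H\<rparr>\<^esub> y)"
    by (simp add: subtopology_Times)
  have "continuous_map (subtopology T H) (subtopology T H) (\<lambda>x. inv x)"
    using topological subgroup.m_inv_closed[OF H]
    by (auto simp: topological_group_def continuous_map_in_subtopology continuous_map_from_subtopology)
  then show "continuous_map (subtopology T H) (subtopology T H) (\<lambda>x. inv\<^bsub>G\<lparr>carrier := H\<rparr>\<^esub> x)"
    by (rule continuous_map_eq) (use m_inv_consistent[OF H] in auto)
qed

lemma totally_disconnected_subtopology: "totally_disconnected_space (subtopology T S)"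
  unfolding totally_disconnected_space_def
proof (intro ballI equalityI subsetI)
  fix x y assume x: "x \<in> topspace (subtopology T S)" "y \<in> connected_component_of_set (subtopology T S) x"
  then obtain C where "connectedin T C" "x \<in> C" "y \<in> C"
    by (auto simp: connected_component_of_def connectedin_subtopology)
  then have "y \<in> connected_component_of_set T x" by (auto simp: connected_component_of_def)
  then show "y \<in> {x}"
    using periodic x by (auto simp: periodic_group_def totally_disconnected_space_def)
qed (auto simp: connected_component_of_refl)

text \<open>The quotient of \<open>cl_gen G T {b}\<close> by an open subgroup is cyclic, generated
  by the coset of \<open>b\<close>. Its order is a power of \<open>p\<close> exactly when some
  \<open>b [^] (p ^ k)\<close> lies in the subgroup, and it suffices to consider traces of open
  subgroups of \<open>G\<close>.\<close>

lemma primary_component_eq: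
  assumes p: "Factorial_Ring.prime p"
  shows "primary_component G T p = p_part p"
proof -
  have "pro_p_group (G\<lparr>carrier := cl_gen G T {b}\<rparr>) (subtopology T (cl_gen G T {b})) p \<longleftrightarrow>
      (\<forall>U. open_subgroup G T U \<longrightarrow> (\<exists>k. b [^] (p ^ k) \<in> U))" (is "?L \<longleftrightarrow> ?R") if b: "b \<in> carrier G" for b
  proof -
    define C where "C = cl_gen G T {b}"
    define H where "H = G\<lparr>carrier := C\<rparr>"
    have C: "subgroup C G" "b \<in> C" "closedin T C" "compactin T C"
      using b cl_gen_subgroup[of "{b}"] cl_gen_incl[of "{b}"] closedin_cl_gen compactin_cl_gen[OF b]
      by (auto simp: C_def)
    have Cc: "C \<subseteq> carrier G" using C subgroup.subset by blast
    interpret H: comm_group H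
    proof (rule group.group_comm_groupI)
      show "group H" unfolding H_def using subgroup.subgroup_is_group[OF C(1)] is_group .
      show "\<And>x y. x \<in> carrier H \<Longrightarrow> y \<in> carrier H \<Longrightarrow> x \<otimes>\<^bsub>H\<^esub> y = y \<otimes>\<^bsub>H\<^esub> x"
        using Cc m_comm by (auto simp: H_def)
    qed
    have Hpow: "x [^]\<^bsub>H\<^esub> (n::nat) = x [^] n" for x n
      by (simp add: H_def flip: nat_pow_consistent)
    have Hinv: "inv\<^bsub>H\<^esub> x = inv x" if "x \<in> C" for x unfolding H_def using m_inv_consistent[OF C(1) that] .
    have Hmult: "x \<otimes>\<^bsub>H\<^esub> y = x \<otimes> y" for x y by (simp add: H_def)
    have bH: "b \<in> carrier H" using C by (simp add: H_def)
    have base: "topological_group H (subtopology T C) \<and> compact_space (subtopology T C) \<and>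
        Hausdorff_space (subtopology T C) \<and> totally_disconnected_space (subtopology T C)"
      using topological_group_subgroup[OF C(1)] C(4) Hausdorff totally_disconnected_subtopology
      by (simp add: H_def compact_space_subtopology Hausdorff_space_subtopology)
    have "?L \<longleftrightarrow> (\<forall>N. N \<lhd> H \<and> openin (subtopology T C) N \<longrightarrow> (\<exists>k. card (rcosets\<^bsub>H\<^esub> N) = p ^ k))"
      unfolding pro_p_group_def using base by (simp add: H_def C_def)
    also have "\<dots> \<longleftrightarrow> ?R"
    proof (intro iffI allI impI)
      fix U assume L: "\<forall>N. N \<lhd> H \<and> openin (subtopology T C) N \<longrightarrow> (\<exists>k. card (rcosets\<^bsub>H\<^esub> N) = p ^ k)"
        and U: "open_subgroup G T U"
      have "subgroup (U \<inter> C) H"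
        unfolding H_def using U C by (intro subgroup_incl subgroups_Inter_pair) (auto simp: open_subgroup_def)
      then have N: "(U \<inter> C) \<lhd> H" using H.subgroup_imp_normal by blast
      moreover have "openin (subtopology T C) (U \<inter> C)"
        using U by (auto simp: openin_subtopology_Int open_subgroup_def)
      ultimately obtain k where k: "card (rcosets\<^bsub>H\<^esub> (U \<inter> C)) = p ^ k" using L by blast
      interpret N: normal "U \<inter> C" H by (rule N)
      have g: "group (H Mod (U \<inter> C))" by (rule N.factorgroup_is_group)
      have "((U \<inter> C) #>\<^bsub>H\<^esub> b) [^]\<^bsub>H Mod (U \<inter> C)\<^esub> order (H Mod (U \<inter> C)) = \<one>\<^bsub>H Mod (U \<inter> C)\<^esub>"
        using bH by (intro group.pow_order_eq_1[OF g]) (simp add: carrier_FactGroup)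
      moreover have "order (H Mod (U \<inter> C)) = p ^ k" using k by (simp add: order_def FactGroup_def)
      ultimately have "(U \<inter> C) #>\<^bsub>H\<^esub> (b [^] (p ^ k)) = U \<inter> C"
        using N.FactGroup_pow[OF bH, of "p ^ k"] Hpow by simp
      moreover have "b [^] (p ^ k) \<in> carrier H" using subgroup_nat_pow_closed[OF C(1,2)] by (simp add: H_def)
      ultimately have "b [^] (p ^ k) \<in> U \<inter> C" using H.rcos_self[OF _ N.subgroup_axioms] by metis
      then show "\<exists>k. b [^] (p ^ k) \<in> U" by blast
    next
      fix N assume R: ?R and NN: "N \<lhd> H \<and> openin (subtopology T C) N"
      interpret N: normal N H using NN by simp
      obtain W where W: "openin T W" "N = W \<inter> C" using NN by (auto simp: openin_subtopology)
      have "\<one> \<in> W" using N.one_closed W by (simp add: H_def)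
      then obtain U where U: "open_subgroup G T U" "U \<subseteq> W" using compact_open_basis W by blast
      then obtain k where k: "b [^] (p ^ k) \<in> U" using R by blast
      interpret Q: group "H Mod N" by (rule N.factorgroup_is_group)
      let ?a = "N #>\<^bsub>H\<^esub> b"
      have a: "?a \<in> carrier (H Mod N)" using bH by (simp add: carrier_FactGroup)
      \<comment> \<open>The powers of \<open>b\<close> are dense, so every coset of the open
        subgroup \<open>N\<close> contains one.\<close>
      have "carrier (H Mod N) \<subseteq> generate (H Mod N) {?a}"
      proof
        fix c assume "c \<in> carrier (H Mod N)"
        then obtain y where y: "y \<in> C" "c = N #>\<^bsub>H\<^esub> y" by (auto simp: carrier_FactGroup H_def)
        have yc: "y \<in> carrier G" using y Cc by blast
        obtain i :: int where i: "b [^] i \<otimes> inv y \<in> U"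
          using mem_cl_gen_iff[OF b yc] y U unfolding C_def by blast
        have bi: "b [^] i \<in> C" using subgroup_int_pow_closed[OF C(1,2)] .
        then have "b [^] i \<otimes> inv y \<in> N"
          using i y U W C(1) by (auto intro: subgroup.m_closed subgroup.m_inv_closed)
        then have "b [^] i \<in> N #>\<^bsub>H\<^esub> y"
          using N.rcos_module_rev[OF H.is_group, of y "b [^] i"] y bi by (simp add: H_def m_inv_consistent[OF C(1)])
        then have "N #>\<^bsub>H\<^esub> (b [^] i) = c"
          using H.repr_independence[OF _ _ N.subgroup_axioms] y by (simp add: H_def)
        moreover have "b [^] i = b [^]\<^bsub>H\<^esub> i" unfolding H_def using int_pow_consistent[OF C(1,2)] .
        ultimately have "c = ?a [^]\<^bsub>H Mod N\<^esub> i" using N.FactGroup_int_pow[OF bH, of i] by simp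
        then show "c \<in> generate (H Mod N) {?a}" using Q.generate_pow[OF a] by blast
      qed
      then have "carrier (H Mod N) = generate (H Mod N) {?a}" using Q.generate_incl[of "{?a}"] a by blast
      then have "card (rcosets\<^bsub>H\<^esub> N) = Q.ord ?a" using Q.generate_pow_card[OF a] by (simp add: FactGroup_def)
      moreover have "?a [^]\<^bsub>H Mod N\<^esub> (p ^ k) = \<one>\<^bsub>H Mod N\<^esub>"
      proof -
        have "b [^] (p ^ k) \<in> N" using k U W subgroup_nat_pow_closed[OF C(1,2)] by blast
        then show ?thesis
          using N.FactGroup_pow[OF bH, of "p ^ k"] N.rcos_const[OF H.is_group] Hpow by simp
      qed
      then have "Q.ord ?a dvd p ^ k" using Q.pow_eq_id[OF a] by blast
      ultimately show "\<exists>k. card (rcosets\<^bsub>H\<^esub> N) = p ^ k" using divides_primepow_nat[OF p] by metis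
    qed
    finally show ?thesis .
  qed
  then show ?thesis by (auto simp: primary_component_def p_part_iff)
qed

text \<open>A finite cyclic group is closed in a Hausdorff space, so taking the closure adds
  nothing.\<close>

lemma finite_order_primary_component:
  assumes p: "Factorial_Ring.prime p" and b: "b \<in> p_part p" and n: "0 < n" "b [^] (n::nat) = \<one>"
  shows "finite (cl_gen G T {b}) \<and> generate G {b} = cl_gen G T {b} \<and> (\<exists>k. card (cl_gen G T {b}) = p ^ k)"
proof -
  have bc: "b \<in> carrier G" using b by (simp add: p_part_iff)
  have "ord b dvd n" using pow_eq_id[OF bc] n by blast
  then have ob: "0 < ord b" using n by (auto intro: gr0I)
  have card: "ord b = card (generate G {b})" using generate_pow_card[OF bc] .
  then have fin: "finite (generate G {b})" using ob card_ge_0_finite by simp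
  then have "closedin T (generate G {b})"
    using Hausdorff generate_incl[of "{b}"] bc by (intro closedin_Hausdorff_finite) auto
  then have eq: "cl_gen G T {b} = generate G {b}" unfolding cl_gen_def by (rule closure_of_closedin)
  obtain m where m: "ord b = p ^ multiplicity p (ord b) * m" "\<not> p dvd m"
    using ob p multiplicity_decompose'[of "ord b" p] by (metis not_prime_unit less_numeral_extra(3))
  \<comment> \<open>Raising \<open>b\<close> to the \<open>p\<close>-part of its order gives an
    element of both \<open>p_part p\<close> and \<open>coprime_part p\<close>, hence
    \<open>\<one>\<close>; so the order is a power of \<open>p\<close>.\<close>
  define c where "c = b [^] (p ^ multiplicity p (ord b))"
  have cc: "c \<in> carrier G" using bc by (simp add: c_def)
  have "c [^] m = \<one>" using bc m(1) pow_ord_eq_1[OF bc] by (simp add: c_def nat_pow_pow)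
  moreover have "coprime m p" using m p prime_imp_coprime coprime_commute by metis
  ultimately have "c \<in> coprime_part p"
    using cc by (auto simp: coprime_part_def torsion_modulo_def open_subgroup_def intro!: exI[of _ m] subgroup.one_closed)
  moreover have "c \<in> p_part p" unfolding c_def using subgroup_nat_pow_closed[OF p_part_subgroup b] .
  ultimately have "c = \<one>" using p_part_Int_coprime_part by blast
  then have "ord b dvd p ^ multiplicity p (ord b)" using pow_eq_id[OF bc] by (simp add: c_def)
  then have "\<exists>k. ord b = p ^ k" using divides_primepow_nat[OF p] by blast
  then show ?thesis using fin eq card by simp
qed

end

section \<open>Infinite monothetic primary groups as \<open>p\<close>-adic integers\<close>

locale infinite_procyclic = td_comm_group +
  fixes p b
  assumes p: "Factorial_Ring.prime (p::nat)" and b: "b \<in> p_part p"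
    and infinite_order: "\<And>n::nat. 0 < n \<Longrightarrow> b [^] n \<noteq> \<one>"
begin

text \<open>Under the isomorphism built below, \<open>layer n\<close> corresponds to
  \<open>p ^ n\<close> times the \<open>p\<close>-adic integers.\<close>

definition layer :: "nat \<Rightarrow> 'a set" where "layer n = cl_gen G T {b [^] (p ^ n)}"

lemma bc: "b \<in> carrier G" using b by (simp add: p_part_iff)

lemma layer_subgroup: "subgroup (layer n) G" unfolding layer_def using bc by (intro cl_gen_subgroup) simp

lemma layer_closed: "closedin T (layer n)" unfolding layer_def by (rule closedin_cl_gen)

lemma pow_in_layer: "int p ^ n dvd i \<Longrightarrow> b [^] i \<in> layer n"
proof -
  assume "int p ^ n dvd i"
  then obtain j where j: "i = int (p ^ n) * j" by auto
  have "b [^] i = (b [^] (p ^ n)) [^] j"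
    unfolding j using int_pow_pow[OF bc, of "int (p ^ n)" j] by (simp only: int_pow_int)
  moreover have "b [^] (p ^ n) \<in> layer n" unfolding layer_def using cl_gen_incl[of "{b [^] (p ^ n)}"] bc by simp
  ultimately show ?thesis using subgroup_int_pow_closed[OF layer_subgroup] by simp
qed

lemma layer_Suc: "layer (Suc n) \<subseteq> layer n"
  unfolding layer_def[of "Suc n"]
  using pow_in_layer[of n "int (p ^ Suc n)", unfolded int_pow_int]
  by (intro cl_gen_minimal layer_subgroup layer_closed) simp

text \<open>An open subgroup is closed and contains some \<open>b [^] (p ^ k)\<close>; thus the
  layers shrink to the identity.\<close>

lemma layer_subset_open:
  assumes "open_subgroup G T U"
  shows "\<exists>k. layer k \<subseteq> U"
proof -
  obtain k where "b [^] (p ^ k) \<in> U" using b assms by (auto simp: p_part_iff)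
  then have "layer k \<subseteq> U" unfolding layer_def
    using assms open_subgroup_closedin by (intro cl_gen_minimal) (auto simp: open_subgroup_def)
  then show ?thesis by blast
qed

text \<open>If \<open>i = p\<^sup>v u\<close> with \<open>p\<close> not dividing \<open>u\<close> and \<open>v < n\<close>, then \<open>c = b\<^bsup>p\<^sup>v\<^esup>\<close> satisfies
  \<open>c\<^sup>u \<in> \<langle>c\<^sup>p\<rangle>\<close> modulo every open subgroup, so the \<open>p\<close>-element \<open>c\<close> is also a \<open>p'\<close>-element.\<close>

lemma pow_in_layer_iff: "b [^] i \<in> layer n \<longleftrightarrow> int p ^ n dvd i"
proof
  assume mem: "b [^] i \<in> layer n"
  show "int p ^ n dvd i"
  proof (rule ccontr)
    assume nd: "\<not> int p ^ n dvd i"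
    then have i0: "i \<noteq> 0" by auto
    have pp: "Factorial_Ring.prime (int p)" using p by simp
    define v where "v = multiplicity (int p) i"
    obtain u where u: "i = int p ^ v * u" "\<not> int p dvd u"
      using multiplicity_decompose'[OF i0, of "int p"] pp unfolding v_def by (metis not_prime_unit)
    have vn: "v < n" using nd u(1) by (metis dvd_triv_left le_imp_power_dvd dvd_trans not_less)
    define c where "c = b [^] (p ^ v)"
    have cc: "c \<in> carrier G" using bc by (simp add: c_def)
    have cp: "c \<in> p_part p" unfolding c_def using subgroup_nat_pow_closed[OF p_part_subgroup b] .
    have cpow: "c [^] j = b [^] (int p ^ v * j)" for j :: int
      unfolding c_def using int_pow_pow[OF bc, of "int (p ^ v)" j, unfolded int_pow_int] by simp
    have "c \<in> coprime_part p"
      unfolding coprime_part_def torsion_modulo_def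
    proof (intro CollectI conjI allI impI cc)
      fix U assume U: "open_subgroup G T U"
      then have sU: "subgroup U G" by (simp add: open_subgroup_def)
      obtain j :: int where j: "(b [^] (p ^ n)) [^] j \<otimes> inv (b [^] i) \<in> U"
        using mem_cl_gen_iff[of "b [^] (p ^ n)" "b [^] i"] mem U bc unfolding layer_def by auto
      \<comment> \<open>The exponent \<open>e\<close> satisfies \<open>c [^] e \<in> U\<close> and
        is prime to \<open>p\<close>, because \<open>p\<close> divides \<open>p ^ (n - v)\<close>
        but not \<open>u\<close>.\<close>
      define e where "e = int p ^ (n - v) * j - u"
      have "int p ^ n = int p ^ v * int p ^ (n - v)" using vn by (simp flip: power_add)
      then have e: "int p ^ n * j - i = int p ^ v * e" by (simp add: e_def u(1) algebra_simps)
      have "(b [^] (p ^ n)) [^] j = b [^] (int p ^ n * j)"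
        using int_pow_pow[OF bc, of "int (p ^ n)" j, unfolded int_pow_int] by simp
      then have "c [^] e \<in> U" using j bc e by (simp add: cpow flip: int_pow_diff)
      \<comment> \<open>\<open>torsion_modulo\<close> uses natural exponents, so the sign of
        \<open>e\<close> is absorbed by a further power.\<close>
      moreover have "int (nat \<bar>e\<bar>) = e * sgn e" by (simp add: sgn_if)
      ultimately have "c [^] (int (nat \<bar>e\<bar>)) \<in> U"
        using subgroup_int_pow_closed[OF sU, of "c [^] e" "sgn e"] cc by (simp only: int_pow_pow)
      moreover have "coprime (nat \<bar>e\<bar>) p"
      proof -
        have "int p dvd int p ^ (n - v)" using vn by (intro dvd_power) auto
        then have "\<not> int p dvd e" using u(2) unfolding e_def by (meson dvd_diff_right_iff dvd_mult2 dvd_diff dvd_trans zdvd_zdiffD)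
        then have "coprime e (int p)" using pp prime_imp_coprime coprime_commute by metis
        then show ?thesis by (metis coprime_abs_left_iff coprime_int_iff nat_0_le abs_ge_zero)
      qed
      ultimately show "\<exists>m \<in> {m. coprime m p}. c [^] m \<in> U"
        by (intro bexI[of _ "nat \<bar>e\<bar>"]) (simp_all only: int_pow_int mem_Collect_eq)
    qed
    then have "c = \<one>" using p_part_Int_coprime_part cp by blast
    moreover have "0 < p ^ v" using prime_gt_0_nat[OF p] by simp
    ultimately show False using infinite_order[of "p ^ v"] by (simp add: c_def)
  qed
qed (rule pow_in_layer)

abbreviation "C \<equiv> cl_gen G T {b}"

lemma C_subgroup: "subgroup C G" "b \<in> C" using bc cl_gen_subgroup cl_gen_incl[of "{b}"] by auto

lemma C_carrier: "x \<in> C \<Longrightarrow> x \<in> carrier G" using C_subgroup subgroup.subset by blast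

text \<open>Finitely many cosets of \<open>layer n\<close> contain all powers of \<open>b\<close>.
  Their union is closed, so it contains \<open>C\<close>.\<close>

lemma digit_exists:
  assumes x: "x \<in> C"
  shows "\<exists>i. 0 \<le> i \<and> i < int p ^ n \<and> x \<otimes> inv (b [^] i) \<in> layer n"
proof -
  let ?S = "\<Union>i \<in> {0..<int p ^ n}. layer n #> (b [^] i)"
  have "closedin T ?S"
    using closedin_r_coset[OF layer_closed] bc by (intro closedin_Union) auto
  moreover have "generate G {b} \<subseteq> ?S"
  proof
    fix y assume "y \<in> generate G {b}"
    then obtain j :: int where j: "y = b [^] j" using generate_pow[OF bc] by auto
    have pos: "0 < int p ^ n" using prime_gt_0_nat[OF p] by simp
    have "b [^] j \<otimes> inv (b [^] (j mod int p ^ n)) = b [^] (j - j mod int p ^ n)" using bc by (simp add: int_pow_diff)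
    also have "\<dots> \<in> layer n" by (rule pow_in_layer) (simp add: minus_mod_eq_mult_div)
    finally have "y \<in> layer n #> (b [^] (j mod int p ^ n))"
      using mem_r_coset_iff[OF layer_subgroup] bc j by simp
    then show "y \<in> ?S" using pos by (intro UN_I[of "j mod int p ^ n"]) auto
  qed
  ultimately have "C \<subseteq> ?S" unfolding cl_gen_def by (rule closure_of_minimal[rotated])
  then show ?thesis using x mem_r_coset_iff[OF layer_subgroup] bc by fastforce
qed

text \<open>The value is the residue of \<open>x\<close> modulo \<open>p ^ n\<close>, not a single
  digit: it is coordinate \<open>n\<close> of the corresponding \<open>p\<close>-adic integer. On
  \<open>C\<close> it is well defined by \<open>digit_exists\<close> and
  \<open>digit_unique\<close>.\<close>

definition digits :: "'a \<Rightarrow> nat \<Rightarrow> int" where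
  "digits x n = (THE i. 0 \<le> i \<and> i < int p ^ n \<and> x \<otimes> inv (b [^] i) \<in> layer n)"

lemma digit_unique:
  assumes x: "x \<in> carrier G" and i: "0 \<le> i" "i < int p ^ n" "x \<otimes> inv (b [^] i) \<in> layer n"
    and j: "0 \<le> j" "j < int p ^ n" "x \<otimes> inv (b [^] j) \<in> layer n"
  shows "i = j"
proof -
  have "b [^] i \<otimes> inv (b [^] j) \<in> layer n"
    using cong_trans[OF layer_subgroup _ _ _ cong_sym[OF layer_subgroup _ _ i(3)] j(3)] x bc by simp
  then have "int p ^ n dvd i - j" using bc pow_in_layer_iff by (simp flip: int_pow_diff)
  then have "i mod int p ^ n = j mod int p ^ n" by (simp add: mod_eq_dvd_iff)
  then show ?thesis using i j by simp
qed

lemma digits_eq_iff: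
  assumes x: "x \<in> C"
  shows "digits x n = i \<longleftrightarrow> 0 \<le> i \<and> i < int p ^ n \<and> x \<otimes> inv (b [^] i) \<in> layer n"
proof -
  have "\<exists>!i. 0 \<le> i \<and> i < int p ^ n \<and> x \<otimes> inv (b [^] i) \<in> layer n"
    using digit_exists[OF x] digit_unique[OF C_carrier[OF x]] by blast
  then show ?thesis unfolding digits_def by (metis (mono_tags, lifting) theI')
qed

lemma digitsD:
  assumes "x \<in> C"
  shows "0 \<le> digits x n" "digits x n < int p ^ n" "x \<otimes> inv (b [^] digits x n) \<in> layer n"
  using digits_eq_iff[OF assms, of n "digits x n"] by auto

lemma digits_mod:
  assumes x: "x \<in> C" and j: "x \<otimes> inv (b [^] j) \<in> layer n"
  shows "digits x n = j mod int p ^ n"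
proof -
  have pos: "0 < int p ^ n" using prime_gt_0_nat[OF p] by simp
  have "b [^] j \<otimes> inv (b [^] (j mod int p ^ n)) = b [^] (j - j mod int p ^ n)" using bc by (simp add: int_pow_diff)
  also have "\<dots> \<in> layer n" by (rule pow_in_layer) (simp add: minus_mod_eq_mult_div)
  finally have "x \<otimes> inv (b [^] (j mod int p ^ n)) \<in> layer n"
    using cong_trans[OF layer_subgroup _ _ _ j] C_carrier[OF x] bc by simp
  then show ?thesis using digits_eq_iff[OF x] pos by simp
qed

text \<open>The layers decrease, so the residue at level \<open>Suc n\<close> also represents
  \<open>x\<close> at level \<open>n\<close>.\<close>

lemma digits_padic:
  assumes x: "x \<in> C"
  shows "digits x \<in> padic_carrier p"
  unfolding padic_carrier_def
  using digitsD(1,2)[OF x] digits_mod[OF x subsetD[OF layer_Suc digitsD(3)[OF x]]]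
  by (intro CollectI allI conjI)

lemma digits_mult:
  assumes x: "x \<in> C" and y: "y \<in> C"
  shows "digits (x \<otimes> y) n = (digits x n + digits y n) mod int p ^ n"
proof (rule digits_mod)
  have xy: "x \<in> carrier G" "y \<in> carrier G" using x y C_carrier by auto
  show "x \<otimes> y \<in> C" using x y C_subgroup by (simp add: subgroup.m_closed)
  have "x \<otimes> y \<otimes> inv (b [^] (digits x n + digits y n))
      = (x \<otimes> inv (b [^] digits x n)) \<otimes> (y \<otimes> inv (b [^] digits y n))"
    using xy bc by (simp add: int_pow_mult inv_mult m_ac)
  then show "x \<otimes> y \<otimes> inv (b [^] (digits x n + digits y n)) \<in> layer n"
    using digitsD(3)[OF x] digitsD(3)[OF y] subgroup.m_closed[OF layer_subgroup] by simp
qed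

text \<open>Equal residues put the quotient of \<open>x\<close> and \<open>y\<close> into every
  layer, hence into every open subgroup.\<close>

lemma digits_inj: "inj_on digits C"
proof (rule inj_onI)
  fix x y assume x: "x \<in> C" and y: "y \<in> C" and eq: "digits x = digits y"
  have xy: "x \<in> carrier G" "y \<in> carrier G" using x y C_carrier by auto
  show "x = y"
  proof (rule eq_if_all_open_subgroups[OF xy])
    fix U assume "open_subgroup G T U"
    then obtain k where k: "layer k \<subseteq> U" using layer_subset_open by blast
    have "x \<otimes> inv y \<in> layer k"
      using cong_trans[OF layer_subgroup _ _ _ digitsD(3)[OF x] cong_sym[OF layer_subgroup _ _ digitsD(3)[OF y, folded eq]]]
        xy bc by simp
    then show "x \<otimes> inv y \<in> U" using k by blast
  qed
qed

lemma padic_carrierD: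
  assumes "s \<in> padic_carrier p"
  shows "0 \<le> s n" "s n < int p ^ n" "s (Suc n) mod int p ^ n = s n"
  using assms unfolding padic_carrier_def mem_Collect_eq by metis+

lemma padic_carrier_mod:
  assumes "s \<in> padic_carrier p" "m \<le> n"
  shows "s n mod int p ^ m = s m"
  using assms(2)
proof (induction n rule: dec_induct)
  case base
  then show ?case using padic_carrierD[OF assms(1)] by simp
next
  case (step n)
  have "s (Suc n) mod int p ^ m = (s (Suc n) mod int p ^ n) mod int p ^ m"
    using step(1) by (simp add: mod_mod_cancel le_imp_power_dvd)
  also have "s (Suc n) mod int p ^ n = s n" using padic_carrierD[OF assms(1)] by simp
  finally show ?case using step by simp
qed

text \<open>For a compatible sequence \<open>s\<close>, compactness of \<open>C\<close> supplies a
  limit \<open>u\<close> of the powers \<open>b [^] s n\<close>, and its residues are then read off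
  modulo the closed layers.\<close>

lemma digits_surj: "digits ` C = padic_carrier p"
proof
  show "digits ` C \<subseteq> padic_carrier p" using digits_padic by blast
  show "padic_carrier p \<subseteq> digits ` C"
  proof
    fix s assume s: "s \<in> padic_carrier p"
    have bs: "b [^] (s n) \<otimes> inv (b [^] (s m)) \<in> layer m" if "m \<le> n" for m n
    proof -
      have "int p ^ m dvd s n - s m"
        using padic_carrier_mod[OF s that] by (metis minus_mod_eq_mult_div dvd_triv_left)
      then show ?thesis using pow_in_layer bc by (simp flip: int_pow_diff)
    qed
    \<comment> \<open>Since \<open>s\<close> is compatible, the clause
      \<open>layer n \<subseteq> U\<close> extends the congruence to all later indices.\<close>
    have "\<exists>u \<in> C. \<forall>U. open_subgroup G T U \<longrightarrow> (\<exists>n. layer n \<subseteq> U \<and> u \<otimes> inv (b [^] s n) \<in> U)"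
    proof (rule compact_choice[OF compactin_cl_gen[OF bc]])
      fix U assume U: "open_subgroup G T U"
      obtain n where n: "layer n \<subseteq> U" using layer_subset_open U by blast
      have "b [^] s n \<otimes> inv (b [^] s n) \<in> U" using U bc by (simp add: open_subgroup_def subgroup.one_closed)
      then show "\<exists>u \<in> C. \<exists>n. layer n \<subseteq> U \<and> u \<otimes> inv (b [^] s n) \<in> U"
        using n subgroup_int_pow_closed[OF C_subgroup] by blast
    next
      fix U u v assume U: "open_subgroup G T U" and uv: "u \<in> carrier G" "v \<in> carrier G" "v \<otimes> inv u \<in> U"
        and "\<exists>n. layer n \<subseteq> U \<and> u \<otimes> inv (b [^] s n) \<in> U"
      then obtain n where n: "layer n \<subseteq> U" "u \<otimes> inv (b [^] s n) \<in> U" by blast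
      have "subgroup U G" using U by (simp add: open_subgroup_def)
      then have "v \<otimes> inv (b [^] s n) \<in> U" using cong_trans[of U v u] uv n bc by simp
      then show "\<exists>n. layer n \<subseteq> U \<and> v \<otimes> inv (b [^] s n) \<in> U" using n by blast
    qed blast
    then obtain u where u: "u \<in> C"
      and un: "\<And>U. open_subgroup G T U \<Longrightarrow> \<exists>n. layer n \<subseteq> U \<and> u \<otimes> inv (b [^] s n) \<in> U" by blast
    have uc: "u \<in> carrier G" using u C_carrier by blast
    have "digits u m = s m" for m
    proof -
      let ?x = "u \<otimes> inv (b [^] s m)"
      have xc: "?x \<in> carrier G" using uc bc by simp
      have lc: "layer m \<subseteq> carrier G" using layer_subgroup subgroup.subset by blast
      have "?x \<in> T closure_of (layer m)"
        unfolding in_closure_of_iff[OF lc xc]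
      proof (intro allI impI)
        fix U assume U: "open_subgroup G T U"
        then have sU: "subgroup U G" by (simp add: open_subgroup_def)
        obtain n where n: "layer n \<subseteq> U" "u \<otimes> inv (b [^] s n) \<in> U" using un U by blast
        \<comment> \<open>For \<open>m \<le> n\<close> the quotient of \<open>b [^] s n\<close> by
          \<open>b [^] s m\<close> lies in \<open>layer m\<close> and is congruent to
          \<open>?x\<close>. For \<open>n < m\<close> already \<open>?x \<in> U\<close>, so
          \<open>\<one>\<close> serves.\<close>
        show "\<exists>t \<in> layer m. t \<otimes> inv ?x \<in> U"
        proof (cases "m \<le> n")
          case True
          let ?t = "b [^] s n \<otimes> inv (b [^] s m)"
          have "?t \<otimes> inv ?x = b [^] s n \<otimes> inv u \<otimes> (inv (b [^] s m) \<otimes> b [^] s m)"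
            using bc uc by (simp add: inv_mult m_ac del: l_inv r_inv)
          then have "?t \<otimes> inv ?x = b [^] s n \<otimes> inv u" using bc uc by simp
          then have "?t \<otimes> inv ?x \<in> U" using cong_sym[OF sU uc _ n(2)] bc by simp
          then show ?thesis using bs[OF True] by blast
        next
          case False
          then have "b [^] s m \<otimes> inv (b [^] s n) \<in> U" using bs[of n m] n by auto
          then have "?x \<in> U"
            using cong_trans[OF sU uc _ _ n(2) cong_sym[OF sU]] bc by simp
          then have "\<one> \<otimes> inv ?x \<in> U" using xc sU by (simp add: subgroup.m_inv_closed)
          then show ?thesis using subgroup.one_closed[OF layer_subgroup] by blast
        qed
      qed
      then have "?x \<in> layer m" using layer_closed closure_of_closedin by blast
      then show ?thesis using digits_eq_iff[OF u] padic_carrierD[OF s] by blast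
    qed
    then have "digits u = s" by blast
    then show "s \<in> digits ` C" using u by blast
  qed
qed

text \<open>Continuity of each coordinate is checked on closed sets: a preimage is a finite union of
  closed cosets of \<open>layer n\<close> cut with \<open>C\<close>.\<close>

lemma digits_continuous: "continuous_map (subtopology T C) (padic_topology p) digits"
  unfolding padic_topology_def continuous_map_in_subtopology continuous_map_componentwise_UNIV
proof (intro conjI allI)
  show "digits \<in> topspace (subtopology T C) \<rightarrow> padic_carrier p" using digits_padic by auto
  fix n
  show "continuous_map (subtopology T C) (discrete_topology UNIV) (\<lambda>x. digits x n)"
    unfolding continuous_map_closedin
  proof (intro conjI allI impI)
    fix S :: "int set"
    have C: "C \<subseteq> carrier G" using C_carrier by blast
    have "{x \<in> topspace (subtopology T C). digits x n \<in> S}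
        = (\<Union>i \<in> S \<inter> {0..<int p ^ n}. (layer n #> (b [^] i)) \<inter> C)"
    proof (intro equalityI subsetI)
      fix x assume x: "x \<in> {x \<in> topspace (subtopology T C). digits x n \<in> S}"
      then have xC: "x \<in> C" by simp
      have "x \<in> layer n #> (b [^] digits x n)"
        using digitsD(3)[OF xC] mem_r_coset_iff[OF layer_subgroup] bc C_carrier[OF xC] by simp
      then show "x \<in> (\<Union>i \<in> S \<inter> {0..<int p ^ n}. (layer n #> (b [^] i)) \<inter> C)"
        using x xC digitsD[OF xC, of n] by (intro UN_I[of "digits x n"]) auto
    next
      fix x assume "x \<in> (\<Union>i \<in> S \<inter> {0..<int p ^ n}. (layer n #> (b [^] i)) \<inter> C)"
      then obtain i where i: "i \<in> S" "0 \<le> i" "i < int p ^ n" "x \<in> layer n #> (b [^] i)" "x \<in> C" by auto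
      then have "digits x n = i"
        using digits_eq_iff mem_r_coset_iff[OF layer_subgroup] bc by auto
      then show "x \<in> {x \<in> topspace (subtopology T C). digits x n \<in> S}" using i C by auto
    qed
    moreover have "closedin (subtopology T C) (\<Union>i \<in> S \<inter> {0..<int p ^ n}. (layer n #> (b [^] i)) \<inter> C)"
    proof (rule closedin_Union)
      show "finite ((\<lambda>i. (layer n #> (b [^] i)) \<inter> C) ` (S \<inter> {0..<int p ^ n}))" by simp
      show "closedin (subtopology T C) Z" if "Z \<in> (\<lambda>i. (layer n #> (b [^] i)) \<inter> C) ` (S \<inter> {0..<int p ^ n})" for Z
        using that closedin_r_coset[OF layer_closed, of "b [^] _"] bc unfolding closedin_subtopology by blast
    qed
    ultimately show "closedin (subtopology T C) {x \<in> topspace (subtopology T C). digits x n \<in> S}" by simp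
  qed auto
qed

lemma iso_padic: "top_group_iso (G\<lparr>carrier := C\<rparr>) (subtopology T C) (padic_group p) (padic_topology p)"
  unfolding top_group_iso_def
proof (intro exI[of _ digits] conjI)
  show "digits \<in> iso (G\<lparr>carrier := C\<rparr>) (padic_group p)"
    using digits_inj digits_surj digits_mult
    by (auto simp: iso_def hom_def bij_betw_def padic_group_def)
  have "Hausdorff_space (padic_topology p)"
    unfolding padic_topology_def
    by (intro Hausdorff_space_subtopology) (simp add: Hausdorff_space_product_topology)
  moreover have "topspace (padic_topology p) = padic_carrier p" by (simp add: padic_topology_def)
  moreover have "topspace (subtopology T C) = C" using C_carrier by auto
  moreover have "compact_space (subtopology T C)"
    using compactin_cl_gen[OF bc] by (simp add: compact_space_subtopology)
  ultimately show "homeomorphic_map (subtopology T C) (padic_topology p) digits"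
    using digits_inj digits_surj digits_continuous by (intro continuous_imp_homeomorphic_map) auto
qed

end

lemma (in td_comm_group) Pi_procyclic_if_reduced:
  assumes ind: "inductively_monothetic G T"
    and red: "\<And>H. divisible_subgroup G H \<Longrightarrow> H \<subseteq> {\<one>}"
  shows "Pi_procyclic G T"
proof -
  have "(finite (p_part p) \<and> (\<exists>g \<in> p_part p. generate G {g} = p_part p) \<and> (\<exists>k. card (p_part p) = p ^ k)) \<or>
     top_group_iso (G\<lparr>carrier := p_part p\<rparr>) (subtopology T (p_part p)) (padic_group p) (padic_topology p)"
    if p: "Factorial_Ring.prime p" for p
  proof -
    obtain b where gen: "b \<in> p_part p" "p_part p = cl_gen G T {b}"
      using p_part_monothetic_if_reduced[OF p ind red] by blast
    show ?thesis
    proof (cases "\<exists>n::nat. 0 < n \<and> b [^] n = \<one>")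
      case True
      then obtain n :: nat where n: "0 < n" "b [^] n = \<one>" by blast
      show ?thesis
        using finite_order_primary_component[OF p gen(1) n] gen(1) unfolding gen(2) by blast
    next
      case False
      then interpret infinite_procyclic G T p b
        using p gen(1) td_comm_group_axioms
        by (intro infinite_procyclic.intro infinite_procyclic_axioms.intro) blast+
      show ?thesis using iso_padic gen(2) by simp
    qed
  qed
  then show ?thesis
    unfolding Pi_procyclic_def
    using periodic comm_group_axioms by (simp add: Let_def primary_component_eq)
qed

section \<open>Near abelian groups\<close>

text \<open>A finite subset of the target lifts to the source, and continuity carries closures along
  \<open>f\<close>, so a generator for the lift maps to a generator.\<close>

lemma inductively_monothetic_image:
  assumes G: "top_group G T" and H: "top_group H S"
    and ind: "inductively_monothetic G T"
    and hom: "f \<in> hom G H" and cont: "continuous_map T S f" and surj: "f ` carrier G = carrier H"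
  shows "inductively_monothetic H S"
proof -
  interpret G: top_group G T by (rule G)
  interpret H: top_group H S by (rule H)
  interpret f: group_hom G H f using hom by unfold_locales
  have im: "f ` cl_gen G T E \<subseteq> cl_gen H S (f ` E)" if E: "E \<subseteq> carrier G" for E
  proof -
    have "f ` cl_gen G T E \<subseteq> S closure_of (f ` generate G E)"
      unfolding cl_gen_def using continuous_map_image_closure_subset[OF cont] .
    then show ?thesis unfolding cl_gen_def using f.generate_img[OF E] by simp
  qed
  show ?thesis
    unfolding inductively_monothetic_def
  proof (intro conjI allI impI H.topological)
    fix F assume F: "finite F \<and> F \<subseteq> carrier H"
    then obtain E where E: "E \<subseteq> carrier G" "finite E" "F = f ` E"
      using finite_subset_image[of F f "carrier G"] surj by auto
    obtain g where g: "g \<in> carrier G" "cl_gen G T E = cl_gen G T {g}"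
      using ind E unfolding inductively_monothetic_def by blast
    have fg: "f g \<in> carrier H" using g by simp
    have "F \<subseteq> cl_gen H S {f g}"
      using im[of "{g}"] g G.cl_gen_incl[OF E(1)] E by auto
    then have "cl_gen H S F \<subseteq> cl_gen H S {f g}"
      using H.cl_gen_minimal H.cl_gen_subgroup[of "{f g}"] H.closedin_cl_gen fg by blast
    moreover have "f g \<in> cl_gen H S F"
      using im[OF E(1)] g G.cl_gen_incl[of "{g}"] E by auto
    then have "cl_gen H S {f g} \<subseteq> cl_gen H S F"
      using H.cl_gen_minimal[of "cl_gen H S F" "{f g}"] H.cl_gen_subgroup[of F] H.closedin_cl_gen F by auto
    ultimately show "\<exists>g \<in> carrier H. cl_gen H S F = cl_gen H S {g}" using fg by blast
  qed
qed

lemma (in group) centralizer_subgroup: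
  assumes t: "t \<in> carrier G"
  shows "subgroup {z \<in> carrier G. z \<otimes> t = t \<otimes> z} G"
proof
  fix u v assume "u \<in> {z \<in> carrier G. z \<otimes> t = t \<otimes> z}" "v \<in> {z \<in> carrier G. z \<otimes> t = t \<otimes> z}"
  then show "u \<otimes> v \<in> {z \<in> carrier G. z \<otimes> t = t \<otimes> z}"
    using t by (simp add: m_assoc) (simp flip: m_assoc)
next
  fix u assume "u \<in> {z \<in> carrier G. z \<otimes> t = t \<otimes> z}"
  then have u: "u \<in> carrier G" "u \<otimes> t = t \<otimes> u" by auto
  have "inv u \<otimes> t = inv u \<otimes> (t \<otimes> u) \<otimes> inv u" using u(1) t by (simp add: m_assoc)
  also have "\<dots> = inv u \<otimes> (u \<otimes> t) \<otimes> inv u" using u(2) by simp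
  also have "\<dots> = t \<otimes> inv u" using u(1) t by (simp flip: m_assoc)
  finally show "inv u \<in> {z \<in> carrier G. z \<otimes> t = t \<otimes> z}" using u(1) by simp
qed (use t in auto)

text \<open>As \<open>N\<close> is normal, conjugation acts on its cosets, and this set is the
  stabiliser of the coset of \<open>a\<close>.\<close>

lemma (in group) subgroup_commuting_modulo:
  assumes N: "N \<lhd> G" and a: "a \<in> carrier G"
  shows "subgroup {h \<in> carrier G. h \<otimes> a \<otimes> inv h \<otimes> inv a \<in> N} G"
proof
  interpret N: normal N G by (rule N)
  show "{h \<in> carrier G. h \<otimes> a \<otimes> inv h \<otimes> inv a \<in> N} \<subseteq> carrier G" by blast
  show "\<one> \<in> {h \<in> carrier G. h \<otimes> a \<otimes> inv h \<otimes> inv a \<in> N}" using a by simp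
  fix x assume "x \<in> {h \<in> carrier G. h \<otimes> a \<otimes> inv h \<otimes> inv a \<in> N}"
  then have x: "x \<in> carrier G" "x \<otimes> a \<otimes> inv x \<otimes> inv a \<in> N" by auto
  have "inv x \<otimes> a \<otimes> inv (inv x) \<otimes> inv a = inv x \<otimes> inv (x \<otimes> a \<otimes> inv x \<otimes> inv a) \<otimes> x"
    using x a by (simp add: inv_mult_group m_assoc inv_solve_left')
  then show "inv x \<in> {h \<in> carrier G. h \<otimes> a \<otimes> inv h \<otimes> inv a \<in> N}"
    using x N.inv_op_closed1[OF x(1) N.m_inv_closed[OF x(2)]] by simp
  fix y assume "y \<in> {h \<in> carrier G. h \<otimes> a \<otimes> inv h \<otimes> inv a \<in> N}"
  then have y: "y \<in> carrier G" "y \<otimes> a \<otimes> inv y \<otimes> inv a \<in> N" by auto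
  have canc: "inv a \<otimes> (inv x \<otimes> (x \<otimes> (a \<otimes> z))) = z" if "z \<in> carrier G" for z
    using that x a by (simp flip: m_assoc)
  have "x \<otimes> y \<otimes> a \<otimes> inv (x \<otimes> y) \<otimes> inv a
      = (x \<otimes> (y \<otimes> a \<otimes> inv y \<otimes> inv a) \<otimes> inv x) \<otimes> (x \<otimes> a \<otimes> inv x \<otimes> inv a)"
    using x y a by (simp add: inv_mult_group m_assoc canc)
  then show "x \<otimes> y \<in> {h \<in> carrier G. h \<otimes> a \<otimes> inv h \<otimes> inv a \<in> N}"
    using x y N.m_closed[OF N.inv_op_closed2[OF x(1) y(2)] x(2)] by simp
qed

text \<open>Conjugation permutes the at most \<open>m\<close> residues of \<open>cl_gen G T {a}\<close> modulo \<open>U\<close>, so the orbit of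
  \<open>a\<close> under \<open>h\<close> has length at most \<open>m\<close>, whatever \<open>h\<close> is.\<close>

lemma (in td_group) fact_power_commutes_modulo:
  assumes a: "a \<in> carrier G" and h: "h \<in> carrier G" and U: "open_subgroup G T U"
    and m: "0 < m" "a [^] (m::nat) \<in> U"
    and nC: "cl_gen G T {a} \<lhd> G" and nN: "cl_gen G T {a} \<inter> U \<lhd> G"
  shows "h [^] (fact m :: nat) \<otimes> a \<otimes> inv (h [^] (fact m :: nat)) \<otimes> inv a \<in> cl_gen G T {a} \<inter> U"
proof -
  define C where "C = cl_gen G T {a}"
  define N where "N = C \<inter> U"
  interpret C: normal C G using nC by (simp add: C_def)
  interpret N: normal N G using nN by (simp add: C_def N_def)
  have aC: "a \<in> C" unfolding C_def using cl_gen_incl[of "{a}"] a by simp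
  define f where "f = (\<lambda>i::nat. h [^] i \<otimes> a \<otimes> inv (h [^] i))"
  have fC: "f i \<in> C" for i unfolding f_def using C.inv_op_closed2[OF _ aC] h by simp
  have fc: "f i \<in> carrier G" for i using fC C.subset by blast
  have "\<exists>r<m. a [^] r \<otimes> inv (f i) \<in> N" for i
  proof -
    obtain r where r: "r < m" "a [^] r \<otimes> inv (f i) \<in> U"
      using cl_gen_cong_pow[OF a _ U m, of "f i"] fC unfolding C_def by blast
    moreover have "a [^] r \<otimes> inv (f i) \<in> C"
      using subgroup_nat_pow_closed[OF C.subgroup_axioms aC] fC by simp
    ultimately show ?thesis by (auto simp: N_def)
  qed
  then obtain r where r: "\<And>i. r i < m" "\<And>i. a [^] r i \<otimes> inv (f i) \<in> N" by metis
  \<comment> \<open>Pigeonhole: there are \<open>m + 1\<close> indices in \<open>{..m}\<close>, but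
    \<open>r\<close> takes at most \<open>m\<close> values.\<close>
  have "\<not> inj_on r {..m}"
  proof
    assume "inj_on r {..m}"
    then have "card {..m} \<le> card {..<m}" using r(1) by (intro card_inj_on_le) auto
    then show False by simp
  qed
  then obtain i j where ij: "i < j" "j \<le> m" "r i = r j"
    unfolding inj_on_def by (metis atMost_iff linorder_neqE_nat)
  define d where "d = j - i"
  have d: "0 < d" "d \<le> m" using ij by (auto simp: d_def)
  have "inv (a [^] r i \<otimes> inv (f j)) = f j \<otimes> inv (a [^] r i)" using a fc by (simp add: inv_mult_group)
  then have "f j \<otimes> inv (a [^] r i) \<in> N" using N.m_inv_closed[OF r(2)[of j]] ij(3) by simp
  then have "(f j \<otimes> inv (a [^] r i)) \<otimes> (a [^] r i \<otimes> inv (f i)) \<in> N" using r(2) by simp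
  moreover have "(f j \<otimes> inv (a [^] r i)) \<otimes> (a [^] r i \<otimes> inv (f i)) = f j \<otimes> inv (f i)"
    using a fc by (simp add: m_assoc inv_solve_left')
  ultimately have fN: "f j \<otimes> inv (f i) \<in> N" by simp
  have hj: "h [^] j = h [^] i \<otimes> h [^] d" using h ij by (simp add: d_def nat_pow_mult)
  \<comment> \<open>Conjugating back by \<open>h [^] i\<close> shows that \<open>h [^] d\<close>
    fixes the coset of \<open>a\<close>. Since \<open>1 \<le> d \<le> m\<close>, \<open>d\<close>
    divides \<open>fact m\<close>, so \<open>h [^] fact m\<close> fixes it too.\<close>
  have "inv (h [^] i) \<otimes> (f j \<otimes> inv (f i)) \<otimes> h [^] i = h [^] d \<otimes> a \<otimes> inv (h [^] d) \<otimes> inv a"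
    using h a unfolding f_def hj by (simp add: inv_mult_group m_assoc inv_solve_left')
  then have "h [^] d \<in> {h \<in> carrier G. h \<otimes> a \<otimes> inv h \<otimes> inv a \<in> N}"
    using N.inv_op_closed1[OF _ fN, of "h [^] i"] h by simp
  then have "(h [^] d) [^] (fact m div d :: nat) \<in> {h \<in> carrier G. h \<otimes> a \<otimes> inv h \<otimes> inv a \<in> N}"
    using subgroup_nat_pow_closed[OF subgroup_commuting_modulo[OF N.normal_axioms a]] by blast
  moreover have "d * (fact m div d) = (fact m :: nat)" using d by (simp add: dvd_fact)
  ultimately show ?thesis using h by (simp add: nat_pow_pow N_def C_def)
qed

section \<open>The preimage of the largest divisible subgroup\<close>

theorem theorem3p6:
  fixes G (structure) and T :: "'a topology" and A :: "'a set"
  assumes "periodic_group G T"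
    and "near_abelian G T A"
    and "A_nontrivial G A"
  defines "D \<equiv> largest_divisible_subgroup (G Mod A)"
  defines "GD \<equiv> \<Union>D"
  shows "A \<subseteq> GD \<and> GD \<subseteq> centraliser G A \<and> normal GD G \<and> abelian_set G GD \<and>
         Pi_procyclic (G Mod GD) (quot_top G T GD)"
proof -
  interpret td_group G T using td_group_if_periodic assms(1) .
  have A: "subgroup A G" "closedin T A" "abelian_set G A" "A \<lhd> G" "comm_group (G Mod A)"
    "inductively_monothetic (G Mod A) (quot_top G T A)"
    and normal_sub: "\<And>H. subgroup H G \<Longrightarrow> H \<subseteq> A \<Longrightarrow> closedin T H \<Longrightarrow> H \<lhd> G"
    using assms(2) by (auto simp: near_abelian_def)
  have Ac: "A \<subseteq> carrier G" using A(1) subgroup.subset by blast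
  interpret QA: quotient_td_group G T A
    using A(4,2) td_group_axioms
    by (intro quotient_td_group.intro quotient_td_group_axioms.intro)
  interpret Q: td_comm_group "G Mod A" "quot_top G T A"
    using QA.td_group_quot A(5) by (simp add: td_comm_group_def)
  have D: "D = Q.divisible_part" unfolding D_def using Q.largest_divisible_subgroup_eq A(6) .
  have sD: "subgroup D (G Mod A)" unfolding D by (rule Q.divisible_part_subgroup)
  have dD: "divisible_subgroup (G Mod A) D" unfolding D by (rule Q.divisible_part_divisible)
  have cD: "closedin (quot_top G T A) D" unfolding D by (rule Q.divisible_part_closed)
  have Dsub: "D \<subseteq> carrier (G Mod A)" using sD subgroup.subset by blast
  have GD: "GD = {x \<in> carrier G. A #> x \<in> D}" unfolding GD_def using QA.Union_eq_preimage[OF Dsub] .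
  have GDc: "GD \<subseteq> carrier G" by (auto simp: GD)
  have AGD: "A \<subseteq> GD"
    using subgroup.one_closed[OF sD] by (auto simp: GD_def)
  have closedGD: "closedin T GD"
    using closedin_continuous_map_preimage[OF QA.continuous_proj cD] by (simp add: GD)
  have sGD: "subgroup GD G"
  proof
    show "\<one> \<in> GD" using AGD A(1) subgroup.one_closed by blast
    show "x \<otimes> y \<in> GD" if "x \<in> GD" "y \<in> GD" for x y
      using that subgroup.m_closed[OF sD, of "A #> x" "A #> y"] QA.proj_mult[of x y] by (simp add: GD del: mult_FactGroup)
    show "inv x \<in> GD" if "x \<in> GD" for x
      using that subgroup.m_inv_closed[OF sD, of "A #> x"] QA.proj_inv[of x] by (simp add: GD)
  qed (rule GDc)
  have nGD: "GD \<lhd> G"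
    unfolding normal_inv_iff
  proof (intro conjI ballI sGD)
    fix x h assume x: "x \<in> carrier G" and h: "h \<in> GD"
    have hc: "h \<in> carrier G" using h GDc by blast
    have "A #> (x \<otimes> h \<otimes> inv x) = (A #> x) \<otimes>\<^bsub>G Mod A\<^esub> (A #> h) \<otimes>\<^bsub>G Mod A\<^esub> (A #> inv x)"
      using x hc by (simp add: QA.proj_mult del: mult_FactGroup)
    also have "\<dots> = (A #> h) \<otimes>\<^bsub>G Mod A\<^esub> (A #> x) \<otimes>\<^bsub>G Mod A\<^esub> (A #> inv x)"
      using Q.m_comm[of "A #> x" "A #> h"] x hc by (simp add: QA.carrier_quot del: mult_FactGroup)
    also have "\<dots> = A #> h"
      using x hc by (simp add: QA.proj_mult m_assoc del: mult_FactGroup)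
    finally show "x \<otimes> h \<otimes> inv x \<in> GD" using h x hc by (simp add: GD)
  qed
  have central: "g \<otimes> a = a \<otimes> g" if g: "g \<in> GD" and a: "a \<in> A" for g a
  proof -
    have gc: "g \<in> carrier G" and ac: "a \<in> carrier G" using g GDc a Ac by auto
    let ?C = "cl_gen G T {a}"
    have sC: "subgroup ?C G" using cl_gen_subgroup ac by simp
    have CA: "?C \<subseteq> A" using cl_gen_minimal[OF A(1,2)] a by simp
    have nC: "?C \<lhd> G" using normal_sub sC CA closedin_cl_gen by blast
    have "g \<otimes> a \<otimes> inv g \<otimes> inv a \<in> U" if U: "open_subgroup G T U" for U
    proof -
      have sU: "subgroup U G" using U by (simp add: open_subgroup_def)
      \<comment> \<open>\<open>U\<close> need not be normal, but open subgroups are closed, so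
        \<open>?C \<inter> U\<close> is a closed subgroup of the base and hence normal.\<close>
      have nN: "?C \<inter> U \<lhd> G"
        using sC sU CA closedin_cl_gen open_subgroup_closedin[OF U]
        by (intro normal_sub subgroups_Inter_pair closedin_Int) auto
      obtain m where m: "0 < m" "a [^] (m::nat) \<in> U" using pow_in_open_subgroup[OF ac U] by blast
      have "A #> g \<in> D" using g by (simp add: GD)
      \<comment> \<open>The exponent \<open>m\<close> depends on \<open>a\<close> and
        \<open>U\<close> alone, so a \<open>fact m\<close>-th root of the coset of \<open>g\<close>
        can be taken in the divisible group \<open>D\<close>. The power \<open>?k\<close> of its
        lift differs from \<open>g\<close> by an element of \<open>A\<close>, which commutes with
        \<open>a\<close>.\<close>
      then obtain y where y: "y \<in> D" "y [^]\<^bsub>G Mod A\<^esub> (fact m :: nat) = A #> g"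
        using dD unfolding divisible_subgroup_def by (meson fact_gt_zero)
      then obtain h where h: "h \<in> carrier G" "y = A #> h" using Dsub QA.carrier_quot by blast
      let ?k = "h [^] (fact m :: nat)"
      have "A #> ?k = A #> g" using y h normal.FactGroup_pow[OF A(4) h(1)] by simp
      then have gk: "g \<otimes> inv ?k \<in> A" using QA.proj_eq_iff[of g ?k] gc h by simp
      have S: "subgroup {h \<in> carrier G. h \<otimes> a \<otimes> inv h \<otimes> inv a \<in> ?C \<inter> U} G"
        using subgroup_commuting_modulo[OF nN ac] .
      have "?k \<in> {h \<in> carrier G. h \<otimes> a \<otimes> inv h \<otimes> inv a \<in> ?C \<inter> U}"
        using fact_power_commutes_modulo[OF ac h(1) U m nC nN] h by simp
      moreover have "g \<otimes> inv ?k \<in> {h \<in> carrier G. h \<otimes> a \<otimes> inv h \<otimes> inv a \<in> ?C \<inter> U}"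
      proof -
        have c: "g \<otimes> inv ?k \<in> carrier G" using gc h by simp
        have "g \<otimes> inv ?k \<otimes> a = a \<otimes> (g \<otimes> inv ?k)"
          using A(3) gk a unfolding abelian_set_def by blast
        then have "g \<otimes> inv ?k \<otimes> a \<otimes> inv (g \<otimes> inv ?k) \<otimes> inv a = \<one>" using c ac by (simp add: m_assoc)
        then show ?thesis using c sC sU by (simp add: subgroup.one_closed)
      qed
      ultimately have "g \<otimes> inv ?k \<otimes> ?k \<in> {h \<in> carrier G. h \<otimes> a \<otimes> inv h \<otimes> inv a \<in> ?C \<inter> U}"
        by (rule subgroup.m_closed[OF S, rotated])
      then show ?thesis using gc h by (simp add: m_assoc)
    qed
    then have "g \<otimes> a \<otimes> inv g = a" using eq_if_all_open_subgroups[of "g \<otimes> a \<otimes> inv g" a] gc ac by simp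
    then show ?thesis using gc ac by (metis inv_solve_right m_closed)
  qed
  have centr: "GD \<subseteq> centraliser G A"
    using central GDc by (auto simp: centraliser_def)
  have abel: "x \<otimes> y = y \<otimes> x" if x: "x \<in> GD" and y: "y \<in> GD" for x y
  proof -
    have xc: "x \<in> carrier G" and yc: "y \<in> carrier G" using x y GDc by auto
    have xyQ: "{A #> x, A #> y} \<subseteq> carrier (G Mod A)" using xc yc QA.carrier_quot by auto
    obtain c where c: "c \<in> carrier (G Mod A)"
      "cl_gen (G Mod A) (quot_top G T A) {A #> x, A #> y} = cl_gen (G Mod A) (quot_top G T A) {c}"
      using A(6) xyQ unfolding inductively_monothetic_def by (metis finite.emptyI finite.insertI)
    then obtain g where g: "g \<in> carrier G" "c = A #> g" using QA.carrier_quot by blast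
    have "cl_gen (G Mod A) (quot_top G T A) {A #> x, A #> y} \<subseteq> D"
      using Q.cl_gen_minimal[OF sD cD] x y by (simp add: GD)
    then have "g \<in> GD" using Q.cl_gen_incl[of "{c}"] c g by (auto simp: GD)
    \<comment> \<open>An open set around \<open>z\<close> has open image, which meets the powers of
      \<open>A #> g\<close>. So it contains some \<open>g [^] i\<close> multiplied by an element of
      \<open>A\<close>, and this product lies in \<open>F\<close>.\<close>
    have dense: "z \<in> F" if z: "z \<in> carrier G" "A #> z \<in> cl_gen (G Mod A) (quot_top G T A) {A #> g}"
      and F: "closedin T F" "subgroup F G" "g \<in> F" "A \<subseteq> F" for z F
    proof -
      have "z \<in> T closure_of F"
        unfolding in_closure_of
      proof (intro conjI allI impI)
        fix W assume W: "z \<in> W \<and> openin T W"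
        have "openin (quot_top G T A) ((\<lambda>x. A #> x) ` W)" using QA.open_proj W by (simp add: open_map_def)
        then obtain w where w: "w \<in> W" "A #> w \<in> generate (G Mod A) {A #> g}"
          using z(2) W unfolding cl_gen_def in_closure_of by blast
        have wc: "w \<in> carrier G" using w W openin_subset by fastforce
        obtain i :: int where "A #> w = (A #> g) [^]\<^bsub>G Mod A\<^esub> i"
          using w(2) Q.generate_pow[of "A #> g"] g c by auto
        then have "A #> w = A #> (g [^] i)" using normal.FactGroup_int_pow[OF A(4) g(1)] by simp
        then have "w \<otimes> inv (g [^] i) \<in> F" using QA.proj_eq_iff[of w "g [^] i"] wc g F by auto
        moreover have "g [^] i \<in> F" using subgroup_int_pow_closed[OF F(2,3)] .
        ultimately have "w \<otimes> inv (g [^] i) \<otimes> g [^] i \<in> F" using subgroup.m_closed[OF F(2)] by blast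
        then have "w \<in> F" using wc g by (simp add: m_assoc)
        then show "\<exists>y. y \<in> F \<and> y \<in> W" using w by blast
      qed (use z in simp)
      then show ?thesis using F closure_of_closedin by blast
    qed
    \<comment> \<open>Here \<open>F\<close> is the centraliser of \<open>t\<close>, a closed
      subgroup that contains \<open>A\<close> because \<open>t \<in> GD\<close>.\<close>
    have mem: "z \<otimes> t = t \<otimes> z"
      if "z \<in> carrier G" "A #> z \<in> cl_gen (G Mod A) (quot_top G T A) {A #> g}" "t \<in> GD" "g \<otimes> t = t \<otimes> g" for z t
    proof -
      have t: "t \<in> carrier G" using that GDc by blast
      have "z \<in> {z \<in> carrier G. z \<otimes> t = t \<otimes> z}"
      proof (rule dense[OF that(1,2)])
        show "A \<subseteq> {z \<in> carrier G. z \<otimes> t = t \<otimes> z}" using central[OF that(3)] Ac by fastforce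
      qed (use closedin_centralizer[OF Hausdorff t] centralizer_subgroup[OF t] g that in auto)
      then show ?thesis by simp
    qed
    have xy_in: "A #> x \<in> cl_gen (G Mod A) (quot_top G T A) {A #> g}"
        "A #> y \<in> cl_gen (G Mod A) (quot_top G T A) {A #> g}"
      using Q.cl_gen_incl[OF xyQ] c g by auto
    \<comment> \<open>Two rounds: \<open>t = g\<close> shows that \<open>y\<close> commutes with
      \<open>g\<close>, and then \<open>t = y\<close> shows that \<open>x\<close> commutes with
      \<open>y\<close>.\<close>
    have "y \<otimes> g = g \<otimes> y" using mem[OF yc xy_in(2) \<open>g \<in> GD\<close>] by simp
    then show ?thesis using mem[OF xc xy_in(1) y] by simp
  qed
  interpret QD: quotient_td_group G T GD
    using nGD closedGD td_group_axioms
    by (intro quotient_td_group.intro quotient_td_group_axioms.intro)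
  \<comment> \<open>This is the natural map from \<open>G Mod A\<close> to \<open>G Mod GD\<close>:
    multiplying a coset of \<open>A\<close> by \<open>GD\<close> absorbs \<open>A\<close>.\<close>
  define f where "f = (\<lambda>a. GD <#> a)"
  have f: "f (A #> x) = GD #> x" if "x \<in> carrier G" for x
  proof -
    have "GD <#> A = GD"
    proof
      show "GD <#> A \<subseteq> GD" using AGD sGD by (auto simp: set_mult_def subgroup.m_closed)
      show "GD \<subseteq> GD <#> A"
      proof
        fix x assume "x \<in> GD"
        then have "x = x \<otimes> \<one>" "x \<in> GD" using GDc by auto
        then show "x \<in> GD <#> A" using subgroup.one_closed[OF A(1)] unfolding set_mult_def by blast
      qed
    qed
    then show ?thesis using setmult_rcos_assoc[OF GDc Ac that] by (simp add: f_def)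
  qed
  have fhom: "f \<in> hom (G Mod A) (G Mod GD)"
  proof (rule homI)
    fix a a' assume a: "a \<in> carrier (G Mod A)" "a' \<in> carrier (G Mod A)"
    then obtain x x' where x: "x \<in> carrier G" "x' \<in> carrier G" "a = A #> x" "a' = A #> x'"
      using QA.carrier_quot by auto
    show "f a \<in> carrier (G Mod GD)" using x f QD.carrier_quot by auto
    show "f (a \<otimes>\<^bsub>G Mod A\<^esub> a') = f a \<otimes>\<^bsub>G Mod GD\<^esub> f a'"
      using x f by (simp add: QA.proj_mult QD.proj_mult del: mult_FactGroup)
  qed
  have fsurj: "f ` carrier (G Mod A) = carrier (G Mod GD)"
    unfolding QA.carrier_quot QD.carrier_quot image_image using f by (intro image_cong) auto
  have "continuous_map T (quot_top G T GD) (f \<circ> (\<lambda>x. A #> x))"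
    using QD.continuous_proj by (rule continuous_map_eq) (simp add: f)
  then have fcont: "continuous_map (quot_top G T A) (quot_top G T GD) f"
    using continuous_compose_quotient_map[OF QA.proj_quotient_map] by blast
  have comm: "comm_group (G Mod GD)"
  proof (rule group.group_comm_groupI[OF QD.group_quot])
    fix u v assume "u \<in> carrier (G Mod GD)" "v \<in> carrier (G Mod GD)"
    then have "u \<in> f ` carrier (G Mod A)" "v \<in> f ` carrier (G Mod A)"
      unfolding fsurj .
    then obtain a a' where a: "a \<in> carrier (G Mod A)" "a' \<in> carrier (G Mod A)" "u = f a" "v = f a'"
      by (elim imageE)
    then show "u \<otimes>\<^bsub>G Mod GD\<^esub> v = v \<otimes>\<^bsub>G Mod GD\<^esub> u"
      using hom_mult[OF fhom] Q.m_comm by metis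
  qed
  interpret P: td_comm_group "G Mod GD" "quot_top G T GD"
    using QD.td_group_quot comm by (simp add: td_comm_group_def)
  have indP: "inductively_monothetic (G Mod GD) (quot_top G T GD)"
    using inductively_monothetic_image[OF QA.top_group_axioms_quot QD.top_group_axioms_quot A(6) fhom fcont fsurj] .
  interpret f: group_hom "G Mod A" "G Mod GD" f
    using fhom by unfold_locales
  have f1: "f d = \<one>\<^bsub>G Mod GD\<^esub> \<longleftrightarrow> d \<in> D" if d: "d \<in> carrier (G Mod A)" for d
  proof -
    obtain x where x: "x \<in> carrier G" "d = A #> x" using d QA.carrier_quot by blast
    have "GD #> x = GD \<longleftrightarrow> x \<in> GD"
      using coset_join1[OF _ x(1) sGD] coset_join2[OF x(1) sGD] by blast
    then show ?thesis using x f by (simp add: GD)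
  qed
  have reduced: "H \<subseteq> {\<one>\<^bsub>G Mod GD\<^esub>}" if H: "divisible_subgroup (G Mod GD) H" for H
  proof -
    have sH: "subgroup H (G Mod GD)" using H by (simp add: divisible_subgroup_def)
    \<comment> \<open>The preimage of \<open>H\<close> is an extension of \<open>H\<close> by the
      divisible kernel \<open>D\<close>, hence divisible and contained in \<open>D\<close>; this
      makes \<open>H\<close> trivial.\<close>
    define K where "K = {a \<in> carrier (G Mod A). f a \<in> H}"
    have sK: "subgroup K (G Mod A)"
      unfolding K_def using sH
      by unfold_locales (auto simp: subgroup.one_closed subgroup.m_closed subgroup.m_inv_closed simp del: mult_FactGroup one_FactGroup)
    have "divisible_subgroup (G Mod A) K"
      unfolding divisible_subgroup_def
    proof (intro conjI sK ballI allI impI)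
      fix a and n :: nat assume a: "a \<in> K" and n: "0 < n"
      have ac: "a \<in> carrier (G Mod A)" using a by (simp add: K_def)
      obtain t where t: "t \<in> H" "t [^]\<^bsub>G Mod GD\<^esub> n = f a"
        using H a n unfolding divisible_subgroup_def K_def by blast
      then obtain s where s: "s \<in> carrier (G Mod A)" "t = f s"
        using fsurj subgroup.subset[OF sH] by blast
      \<comment> \<open>The error of the lifted root \<open>s\<close> lies in the kernel
        \<open>D\<close>, and an \<open>n\<close>-th root \<open>d\<close> of it corrects
        \<open>s\<close>.\<close>
      let ?e = "a \<otimes>\<^bsub>G Mod A\<^esub> inv\<^bsub>G Mod A\<^esub> (s [^]\<^bsub>G Mod A\<^esub> n)"
      have ec: "?e \<in> carrier (G Mod A)" using ac s by (simp del: mult_FactGroup)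
      have "f ?e = \<one>\<^bsub>G Mod GD\<^esub>"
        using ac s t by (simp add: f.hom_nat_pow del: mult_FactGroup one_FactGroup)
      then have "?e \<in> D" using f1[OF ec] by blast
      then obtain d where d: "d \<in> D" "d [^]\<^bsub>G Mod A\<^esub> n = ?e"
        using dD n unfolding divisible_subgroup_def by blast
      have dc: "d \<in> carrier (G Mod A)" using d Dsub by blast
      have "(d \<otimes>\<^bsub>G Mod A\<^esub> s) [^]\<^bsub>G Mod A\<^esub> n = a"
        using d s ac dc by (simp add: Q.nat_pow_distrib Q.m_assoc del: mult_FactGroup one_FactGroup)
      moreover have "f (d \<otimes>\<^bsub>G Mod A\<^esub> s) = t"
        using f1[OF dc] d s dc by (simp del: mult_FactGroup one_FactGroup)
      then have "d \<otimes>\<^bsub>G Mod A\<^esub> s \<in> K"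
        using t s dc by (simp add: K_def del: mult_FactGroup one_FactGroup)
      ultimately show "\<exists>y \<in> K. y [^]\<^bsub>G Mod A\<^esub> n = a" by blast
    qed
    then have "K \<subseteq> D" by (auto simp: D_def largest_divisible_subgroup_def)
    show ?thesis
    proof
      fix t assume t: "t \<in> H"
      then obtain s where s: "s \<in> carrier (G Mod A)" "t = f s"
        using fsurj subgroup.subset[OF sH] by blast
      then have "s \<in> D" using t \<open>K \<subseteq> D\<close> by (auto simp: K_def)
      then show "t \<in> {\<one>\<^bsub>G Mod GD\<^esub>}" using f1 s by blast
    qed
  qed
  have "Pi_procyclic (G Mod GD) (quot_top G T GD)"
    using P.Pi_procyclic_if_reduced indP reduced by blast
  then show ?thesis
    using AGD centr nGD abel by (auto simp: abelian_set_def)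
qed

end
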